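(* Let $H$ be an infinite-dimensional separable complex Hilbert space with orthonormal basis $B=\{e_\alpha:\alpha\in\mathbb{Z}^\kappa\}$, $\kappa\in\mathbb{N}$, and let $m>0$. Let the vector-valued Fourier multiplier $A\equiv T_\sigma:L^2(\mathbb{T}^n,H)\to L^2(\mathbb{T}^n,H)$, with operator-valued symbol $\sigma=\{\sigma(\eta)\}_{\eta\in\mathbb{Z}^n}$, be a (closed and densely defined) Fredholm operator. If $A$ is $(m,B)$-elliptic, then the analytical index of $A$ is given by $$\textbf{Ind}(A)=\sum_{\eta\in\mathbb{Z}^n}\textbf{Ind}(\sigma(\eta)).$$
   Context: $\mathbb{T}^n=\mathbb{R}^n/\mathbb{Z}^n$; $\widehat f(\xi)=\int_{\mathbb{T}^n}e^{-2\pi i x\cdot\xi}f(x)\,dx\in H$ for $f\in L^2(\mathbb{T}^n,H)$, $\xi\in\mathbb{Z}^n$. Fourier multiplier: given closed densely defined (possibly unbounded) operators $\sigma(\xi)$ on $H$, $\xi\in\mathbb{Z}^n$, with $B\subset\bigcap_\xi\mathrm{Dom}(\sigma(\xi))$, the operator $A=T_\sigma$ acts by $\widehat{Af}(\xi)=\sigma(\xi)\widehat f(\xi)$, on the domain of all $f\in L^2(\mathbb{T}^n,H)$ with $\widehat f(\xi)\in\mathrm{Dom}(\sigma(\xi))$ for all $\xi$ and $\sum_\xi\|\sigma(\xi)\widehat f(\xi)\|_H^2<\infty$. This domain contains all finite linear combinations of the functions $x\mapsto e^{2\pi i x\cdot\xi}e_\alpha$. The adjoint $A^*$ is the Fourier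 multiplier with symbol $\{\sigma(\xi)^*\}_\xi$. $A$ is $(m,B)$-elliptic if there are constants $C,C'>0$ such that for all $t>0$, $\xi\in\mathbb{Z}^n$, $\alpha\in\mathbb{Z}^\kappa$, $$\|e^{-t\sigma(\xi)^*\sigma(\xi)}e_\alpha\|_H\le C'e^{-tC(1+|\alpha|+|\xi|)^m},\qquad \|e^{-t\sigma(\xi)\sigma(\xi)^*}e_\alpha\|_H\le C'e^{-tC(1+|\alpha|+|\xi|)^m}.$$ A closed densely defined operator $S$ on a Hilbert space is Fredholm if $\ker S$ and $\mathrm{coker}\,S$ are finite-dimensional (with closed range), and $\textbf{Ind}(S)=\dim\ker S-\dim\ker S^*$. *)

theory Defs
  imports "HOL-Analysis.Analysis"
begin

section \<open>Complex inner product spaces and Hilbert spaces\<close>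

text \<open>The inner product is linear in its first argument.\<close>

class complex_inner = real_normed_vector +
  fixes scaleC :: "complex \<Rightarrow> 'a \<Rightarrow> 'a" (infixr "*\<^sub>C" 75)
    and cinner :: "'a \<Rightarrow> 'a \<Rightarrow> complex"
  assumes scaleC_add_right: "a *\<^sub>C (x + y) = a *\<^sub>C x + a *\<^sub>C y"
    and scaleC_add_left: "(a + b) *\<^sub>C x = a *\<^sub>C x + b *\<^sub>C x"
    and scaleC_scaleC: "a *\<^sub>C (b *\<^sub>C x) = (a * b) *\<^sub>C x"
    and scaleC_of_real: "complex_of_real r *\<^sub>C x = r *\<^sub>R x"
    and cinner_commute: "cinner x y = cnj (cinner y x)"
    and cinner_add_left: "cinner (x + y) z = cinner x z + cinner y z"
    and cinner_scaleC_left: "cinner (a *\<^sub>C x) y = a * cinner x y"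
    and cinner_self: "cinner x x = complex_of_real ((norm x)\<^sup>2)"

class complex_hilbert = complex_inner + banach

global_interpretation complex_vector: vector_space "scaleC :: complex \<Rightarrow> 'a \<Rightarrow> 'a::complex_inner"
  defines csubspace = complex_vector.subspace
    and cspan = complex_vector.span
    and cdim = complex_vector.dim
proof unfold_locales
  show "1 *\<^sub>C x = x" for x :: 'a
    using scaleC_of_real[of 1 x] by simp
qed (auto simp: scaleC_add_right scaleC_add_left scaleC_scaleC)

definition cfinite_dim :: "'a::complex_inner set \<Rightarrow> bool" where
  "cfinite_dim V \<longleftrightarrow> (\<exists>F. finite F \<and> V \<subseteq> cspan F)"

definition orthonormal_basis :: "('i \<Rightarrow> 'a::complex_inner) \<Rightarrow> bool" where
  "orthonormal_basis e \<longleftrightarrow>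
     (\<forall>i j. cinner (e i) (e j) = (if i = j then 1 else 0)) \<and> closure (cspan (range e)) = UNIV"

section \<open>Unbounded operators\<close>

text \<open>A possibly unbounded operator is a partial function, defined on its domain \<^const>\<open>dom\<close>.
  Composition of operators, with its natural domain, is then \<^const>\<open>map_comp\<close>.\<close>

definition closed_densely_defined :: "('a::complex_inner \<rightharpoonup> 'a) \<Rightarrow> bool" where
  "closed_densely_defined S \<longleftrightarrow>
     csubspace (dom S) \<and>
     (\<forall>x\<in>dom S. \<forall>y\<in>dom S. the (S (x + y)) = the (S x) + the (S y)) \<and>
     (\<forall>c. \<forall>x\<in>dom S. the (S (c *\<^sub>C x)) = c *\<^sub>C the (S x)) \<and>
     closed (Map.graph S) \<and> closure (dom S) = UNIV"

text \<open>For densely defined \<open>S\<close> there is at most one \<open>z\<close> below.\<close>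

definition adjoint_op :: "('a::complex_inner \<rightharpoonup> 'a) \<Rightarrow> ('a \<rightharpoonup> 'a)" where
  "adjoint_op S y =
     (if \<exists>z. \<forall>x\<in>dom S. cinner (the (S x)) y = cinner x z
      then Some (THE z. \<forall>x\<in>dom S. cinner (the (S x)) y = cinner x z)
      else None)"

definition op_ker :: "('a::complex_inner \<rightharpoonup> 'a) \<Rightarrow> 'a set" where
  "op_ker S = {x. S x = Some 0}"

definition fredholm :: "('a::complex_inner \<rightharpoonup> 'a) \<Rightarrow> bool" where
  "fredholm S \<longleftrightarrow>
     closed_densely_defined S \<and>
     cfinite_dim (op_ker S) \<and>
     closed (ran S) \<and>
     (\<exists>F. finite F \<and> (\<forall>y. \<exists>z\<in>ran S. y - z \<in> cspan F))"
     \<comment> \<open>the last conjunct says that the cokernel, the quotient of the space by \<open>ran S\<close>,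
        is finite-dimensional\<close>

definition Ind :: "('a::complex_inner \<rightharpoonup> 'a) \<Rightarrow> int" where
  "Ind S = int (cdim (op_ker S)) - int (cdim (op_ker (adjoint_op S)))"

section \<open>The semigroup of exponentials\<close>

definition C0_semigroup :: "(real \<Rightarrow> 'a::complex_inner \<Rightarrow> 'a) \<Rightarrow> bool" where
  "C0_semigroup U \<longleftrightarrow>
     (\<forall>t\<ge>0. bounded_linear (U t) \<and> (\<forall>c x. U t (c *\<^sub>C x) = c *\<^sub>C U t x)) \<and>
     (\<forall>x. U 0 x = x) \<and>
     (\<forall>s\<ge>0. \<forall>t\<ge>0. \<forall>x. U (s + t) x = U s (U t x)) \<and>
     (\<forall>x. ((\<lambda>t. U t x) \<longlongrightarrow> x) (at_right 0))"

text \<open>The generator of \<open>U\<close> is \<open>-P\<close>, including equality of the domains.\<close>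

definition has_neg_generator :: "(real \<Rightarrow> 'a::complex_inner \<Rightarrow> 'a) \<Rightarrow> ('a \<rightharpoonup> 'a) \<Rightarrow> bool" where
  "has_neg_generator U P \<longleftrightarrow>
     (\<forall>x y. P x = Some y \<longleftrightarrow> ((\<lambda>t. (x - U t x) /\<^sub>R t) \<longlongrightarrow> y) (at_right 0))"

text \<open>\<open>exp_neg P t\<close> is the operator \<open>e\<^sup>-\<^sup>t\<^sup>P\<close> for \<open>t \<ge> 0\<close>. It is used only for \<open>P = S\<^sup>*S\<close> and
  \<open>P = SS\<^sup>*\<close> with \<open>S\<close> closed and densely defined. Such \<open>P\<close> is self-adjoint and nonnegative
  (von Neumann), so \<open>-P\<close> generates a strongly continuous semigroup, whose values at \<open>t \<ge> 0\<close> are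
  uniquely determined by \<open>P\<close> and agree with those of the functional calculus.\<close>

definition exp_neg :: "('a::complex_inner \<rightharpoonup> 'a) \<Rightarrow> real \<Rightarrow> 'a \<Rightarrow> 'a" where
  "exp_neg P = (SOME U. C0_semigroup U \<and> has_neg_generator U P)"

section \<open>Square-integrable functions on the torus\<close>

text \<open>The torus is modelled by its fundamental domain, the half-open unit cube with Lebesgue
  measure.\<close>

definition torus_measure :: "(real^'n) measure" where
  "torus_measure = restrict_space lborel {x. \<forall>i. 0 \<le> x $ i \<and> x $ i < 1}"

definition square_integrable ::
  "(real^'n \<Rightarrow> 'h::{complex_hilbert, second_countable_topology}) \<Rightarrow> bool" where
  "square_integrable f \<longleftrightarrow>
     f \<in> borel_measurable torus_measure \<and> integrable torus_measure (\<lambda>x. (norm (f x))\<^sup>2)"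

definition torus_rel ::
  "(real^'n \<Rightarrow> 'h::{complex_hilbert, second_countable_topology}) \<Rightarrow> (real^'n \<Rightarrow> 'h) \<Rightarrow> bool" where
  "torus_rel f g \<longleftrightarrow>
     square_integrable f \<and> square_integrable g \<and> (AE x in torus_measure. f x = g x)"

lemma square_integrable_zero: "square_integrable (\<lambda>x. 0)"
  by (simp add: square_integrable_def)

quotient_type (overloaded) ('n, 'h) torus_L2 =
  "real^'n::finite \<Rightarrow> 'h::{complex_hilbert, second_countable_topology}" / partial: torus_rel
proof (rule part_equivpI)
  show "\<exists>f::real^'n \<Rightarrow> 'h. torus_rel f f"
    using square_integrable_zero by (auto simp: torus_rel_def)
  show "symp (torus_rel :: (real^'n \<Rightarrow> 'h) \<Rightarrow> _)"
    by (rule sympI) (auto simp: torus_rel_def eq_commute)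
  show "transp (torus_rel :: (real^'n \<Rightarrow> 'h) \<Rightarrow> _)"
    by (rule transpI) (auto simp: torus_rel_def elim: AE_mp)
qed

subsection \<open>Auxiliary facts for the vector space operations\<close>

lemma scaleC_eq: "a *\<^sub>C x = Re a *\<^sub>R x + Im a *\<^sub>R (\<i> *\<^sub>C (x::'a::complex_inner))"
proof -
  have "a *\<^sub>C x = (complex_of_real (Re a) + complex_of_real (Im a) * \<i>) *\<^sub>C x"
    by (metis complex_eq mult.commute)
  then show ?thesis
    by (simp only: scaleC_add_left scaleC_scaleC[symmetric] scaleC_of_real)
qed

lemma norm_scaleC: "norm (a *\<^sub>C x) = cmod a * norm (x::'a::complex_inner)"
proof -
  have "cinner (a *\<^sub>C x) (a *\<^sub>C x) = a * cnj (a * cinner x x)"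
    by (metis cinner_commute cinner_scaleC_left)
  also have "\<dots> = complex_of_real ((cmod a)\<^sup>2 * (norm x)\<^sup>2)"
    by (simp add: cinner_self complex_norm_square[symmetric] del: of_real_power)
  finally have "complex_of_real ((norm (a *\<^sub>C x))\<^sup>2) = complex_of_real ((cmod a * norm x)\<^sup>2)"
    unfolding cinner_self power_mult_distrib .
  then have "(norm (a *\<^sub>C x))\<^sup>2 = (cmod a * norm x)\<^sup>2"
    by (simp only: of_real_eq_iff)
  then show ?thesis
    by (simp add: power2_eq_iff_nonneg)
qed

lemma cinner_add_right: "cinner z (x + y) = cinner z x + cinner z (y::'a::complex_inner)"
  by (metis cinner_commute cinner_add_left complex_cnj_add)

lemma cinner_scaleC_right: "cinner y (a *\<^sub>C x) = cnj a * cinner y (x::'a::complex_inner)"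
  by (metis cinner_commute cinner_scaleC_left complex_cnj_mult)

lemma norm_add_square:
  "(norm (x + y))\<^sup>2 = (norm x)\<^sup>2 + 2 * Re (cinner x y) + (norm (y::'a::complex_inner))\<^sup>2"
proof -
  have "complex_of_real ((norm (x + y))\<^sup>2)
      = of_real ((norm x)\<^sup>2) + (cinner x y + cinner y x) + of_real ((norm y)\<^sup>2)"
    unfolding cinner_self[symmetric] by (simp add: cinner_add_left cinner_add_right)
  also have "cinner x y + cinner y x = of_real (2 * Re (cinner x y))"
    by (subst cinner_commute[of y x]) (simp add: complex_add_cnj)
  finally show ?thesis
    by (metis of_real_add of_real_eq_iff)
qed

text \<open>The Cauchy-Schwarz argument, for nonnegative quadratic forms.\<close>

lemma nonneg_quadratic_bound:
  fixes a b r :: real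
  assumes "0 \<le> a" "0 \<le> b" and q: "\<And>t. 0 \<le> a + 2 * t * r + t\<^sup>2 * b"
  shows "\<bar>r\<bar> \<le> sqrt a * sqrt b"
proof (cases "b = 0")
  case True
  have "r = 0"
  proof (rule ccontr)
    assume "r \<noteq> 0"
    then show False
      using q[of "- (a + 1) / (2 * r)"] True by (simp add: field_simps)
  qed
  then show ?thesis
    using assms by simp
next
  case False
  then have "b > 0" using assms by simp
  then have "r\<^sup>2 \<le> a * b"
    using q[of "- r / b"] by (simp add: field_simps power2_eq_square)
  then have "sqrt (r\<^sup>2) \<le> sqrt (a * b)"
    by (rule real_sqrt_le_mono)
  then show ?thesis
    by (simp add: real_sqrt_mult)
qed

lemma abs_Re_cinner_le: "\<bar>Re (cinner x y)\<bar> \<le> norm x * norm (y::'a::complex_inner)"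
proof -
  have "0 \<le> (norm x)\<^sup>2 + 2 * t * Re (cinner x y) + t\<^sup>2 * (norm y)\<^sup>2" for t
  proof -
    have "cinner x (t *\<^sub>R y) = of_real t * cinner x y"
      by (metis cinner_scaleC_right complex_cnj_complex_of_real scaleC_of_real)
    then show ?thesis
      using norm_add_square[of x "t *\<^sub>R y"] zero_le_power2[of "norm (x + t *\<^sub>R y)"]
      by (simp add: power_mult_distrib)
  qed
  from nonneg_quadratic_bound[OF _ _ this] show ?thesis
    by simp
qed

lemma norm_cinner_le: "cmod (cinner x y) \<le> 2 * (norm x * norm (y::'a::complex_inner))"
proof -
  have "Im (cinner x y) = Re (cinner x (\<i> *\<^sub>C y))"
    by (simp add: cinner_scaleC_right)
  then have "\<bar>Im (cinner x y)\<bar> \<le> norm x * norm y"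
    using abs_Re_cinner_le[of x "\<i> *\<^sub>C y"] by (simp add: norm_scaleC)
  then show ?thesis
    using abs_Re_cinner_le[of x y] cmod_le[of "cinner x y"] by linarith
qed

lemma bounded_bilinear_cinner:
  "bounded_bilinear (cinner :: 'a::complex_inner \<Rightarrow> 'a \<Rightarrow> complex)"
proof
  show "cinner (r *\<^sub>R x) y = r *\<^sub>R cinner x y" for r and x y :: 'a
    by (simp add: cinner_scaleC_left scaleC_of_real[symmetric] scaleR_conv_of_real)
  show "cinner x (r *\<^sub>R y) = r *\<^sub>R cinner x y" for r and x y :: 'a
    by (simp add: cinner_scaleC_right scaleC_of_real[symmetric] scaleR_conv_of_real)
  show "\<exists>K. \<forall>x y :: 'a. cmod (cinner x y) \<le> norm x * norm y * K"
    by (rule exI[of _ 2]) (simp add: norm_cinner_le mult.commute)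
qed (simp_all add: cinner_add_left cinner_add_right)

lemma bounded_linear_scaleC: "bounded_linear (\<lambda>x::'a::complex_inner. c *\<^sub>C x)"
proof
  show "c *\<^sub>C (r *\<^sub>R x) = r *\<^sub>R (c *\<^sub>C x)" for r and x :: 'a
    by (simp add: scaleC_of_real[symmetric] scaleC_scaleC mult.commute)
  show "\<exists>K. \<forall>x::'a. norm (c *\<^sub>C x) \<le> norm x * K"
    by (rule exI[of _ "cmod c"]) (simp add: norm_scaleC mult.commute)
qed (simp add: scaleC_add_right)

lemma borel_measurable_scaleC:
  fixes g :: "'b \<Rightarrow> 'a::{complex_inner, second_countable_topology}"
  assumes "a \<in> borel_measurable M" and g: "g \<in> borel_measurable M"
  shows "(\<lambda>x. a x *\<^sub>C g x) \<in> borel_measurable M"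
proof -
  have "(\<lambda>x. \<i> *\<^sub>C g x) \<in> borel_measurable M"
    using borel_measurable_continuous_onI[OF linear_continuous_on[OF bounded_linear_scaleC]] g
    by (rule measurable_compose[rotated])
  moreover have "(\<lambda>x. Re (a x)) \<in> borel_measurable M" "(\<lambda>x. Im (a x)) \<in> borel_measurable M"
    using assms(1) by auto
  ultimately show ?thesis
    using g unfolding scaleC_eq[of "a _"] by auto
qed

lemma borel_measurable_cinner:
  fixes f g :: "'b \<Rightarrow> 'a::{complex_inner, second_countable_topology}"
  assumes "f \<in> borel_measurable M" "g \<in> borel_measurable M"
  shows "(\<lambda>x. cinner (f x) (g x)) \<in> borel_measurable M"
  by (rule borel_measurable_continuous_Pair[OF assms])
    (intro bounded_bilinear.continuous_on[OF bounded_bilinear_cinner] continuous_intros)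

lemma square_integrable_add:
  fixes f g :: "real^'n \<Rightarrow> 'h::{complex_hilbert, second_countable_topology}"
  assumes f: "square_integrable f" and g: "square_integrable g"
  shows "square_integrable (\<lambda>x. f x + g x)"
proof -
  have m: "f \<in> borel_measurable torus_measure" "g \<in> borel_measurable torus_measure"
    and i: "integrable torus_measure (\<lambda>x. 2 * (norm (f x))\<^sup>2 + 2 * (norm (g x))\<^sup>2)"
    using assms by (auto simp: square_integrable_def)
  have "(norm (f x + g x))\<^sup>2 \<le> 2 * (norm (f x))\<^sup>2 + 2 * (norm (g x))\<^sup>2" for x
  proof -
    have "(norm (f x + g x))\<^sup>2 \<le> (norm (f x) + norm (g x))\<^sup>2"
      by (intro power_mono norm_triangle_ineq norm_ge_zero)
    then show ?thesis
      using zero_le_power2[of "norm (f x) - norm (g x)"]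
      by (simp add: power2_sum power2_diff)
  qed
  then have "integrable torus_measure (\<lambda>x. (norm (f x + g x))\<^sup>2)"
    using m by (intro Bochner_Integration.integrable_bound[OF i]) (auto intro!: AE_I2)
  then show ?thesis
    using m by (auto simp: square_integrable_def)
qed

lemma square_integrable_scaleC:
  fixes f :: "real^'n \<Rightarrow> 'h::{complex_hilbert, second_countable_topology}"
  assumes "square_integrable f"
  shows "square_integrable (\<lambda>x. c *\<^sub>C f x)"
  using assms borel_measurable_scaleC[of "\<lambda>x. c" torus_measure f]
  by (auto simp: square_integrable_def norm_scaleC power_mult_distrib)

lemma square_integrable_scaleR:
  fixes f :: "real^'n \<Rightarrow> 'h::{complex_hilbert, second_countable_topology}"
  assumes "square_integrable f"
  shows "square_integrable (\<lambda>x. r *\<^sub>R f x)"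
  using square_integrable_scaleC[OF assms, of "of_real r"] by (simp add: scaleC_of_real)

lemma square_integrable_uminus:
  fixes f :: "real^'n \<Rightarrow> 'h::{complex_hilbert, second_countable_topology}"
  assumes "square_integrable f"
  shows "square_integrable (\<lambda>x. - f x)"
  using square_integrable_scaleR[OF assms, of "- 1"] by simp

lemma square_integrable_diff:
  fixes f :: "real^'n \<Rightarrow> 'h::{complex_hilbert, second_countable_topology}"
  assumes "square_integrable f" "square_integrable g"
  shows "square_integrable (\<lambda>x. f x - g x)"
  using square_integrable_add[OF assms(1) square_integrable_uminus[OF assms(2)]] by simp

lemma integrable_cinner:
  fixes f g :: "real^'n \<Rightarrow> 'h::{complex_hilbert, second_countable_topology}"
  assumes f: "square_integrable f" and g: "square_integrable g"
  shows "integrable torus_measure (\<lambda>x. cinner (f x) (g x))"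
proof -
  have m: "f \<in> borel_measurable torus_measure" "g \<in> borel_measurable torus_measure"
    and i: "integrable torus_measure (\<lambda>x. (norm (f x))\<^sup>2 + (norm (g x))\<^sup>2)"
    using assms by (auto simp: square_integrable_def)
  have "cmod (cinner (f x) (g x)) \<le> norm ((norm (f x))\<^sup>2 + (norm (g x))\<^sup>2)" for x
    using norm_cinner_le[of "f x" "g x"] zero_le_power2[of "norm (f x) - norm (g x)"]
    by (simp add: power2_diff)
  then show ?thesis
    using m by (intro Bochner_Integration.integrable_bound[OF i] borel_measurable_cinner AE_I2)
qed

lemma integral_norm_add_square:
  fixes f g :: "real^'n \<Rightarrow> 'h::{complex_hilbert, second_countable_topology}"
  assumes f: "square_integrable f" and g: "square_integrable g"
  shows "(LINT x|torus_measure. (norm (f x + g x))\<^sup>2) =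
    (LINT x|torus_measure. (norm (f x))\<^sup>2) + 2 * Re (LINT x|torus_measure. cinner (f x) (g x))
    + (LINT x|torus_measure. (norm (g x))\<^sup>2)"
  using assms integrable_cinner[OF f g]
  by (simp add: norm_add_square square_integrable_def)

lemma sqrt_integral_norm_triangle:
  fixes f g :: "real^'n \<Rightarrow> 'h::{complex_hilbert, second_countable_topology}"
  assumes f: "square_integrable f" and g: "square_integrable g"
  shows "sqrt (LINT x|torus_measure. (norm (f x + g x))\<^sup>2) \<le>
    sqrt (LINT x|torus_measure. (norm (f x))\<^sup>2) + sqrt (LINT x|torus_measure. (norm (g x))\<^sup>2)"
proof -
  let ?a = "LINT x|torus_measure. (norm (f x))\<^sup>2"
  let ?b = "LINT x|torus_measure. (norm (g x))\<^sup>2"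
  let ?r = "Re (LINT x|torus_measure. cinner (f x) (g x))"
  have ab: "0 \<le> ?a" "0 \<le> ?b" by simp_all
  have "0 \<le> ?a + 2 * t * ?r + t\<^sup>2 * ?b" for t
  proof -
    have "cinner (f x) (t *\<^sub>R g x) = of_real t * cinner (f x) (g x)" for x
      by (metis cinner_scaleC_right complex_cnj_complex_of_real scaleC_of_real)
    then have "(LINT x|torus_measure. (norm (f x + t *\<^sub>R g x))\<^sup>2) = ?a + 2 * t * ?r + t\<^sup>2 * ?b"
      by (subst integral_norm_add_square[OF f square_integrable_scaleR[OF g]])
        (simp add: power_mult_distrib)
    moreover have "0 \<le> (LINT x|torus_measure. (norm (f x + t *\<^sub>R g x))\<^sup>2)" by simp
    ultimately show ?thesis by simp
  qed
  from nonneg_quadratic_bound[OF ab this] have "?r \<le> sqrt ?a * sqrt ?b" by simp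
  then have "(LINT x|torus_measure. (norm (f x + g x))\<^sup>2) \<le> (sqrt ?a + sqrt ?b)\<^sup>2"
    unfolding integral_norm_add_square[OF f g] by (simp add: power2_sum)
  then show ?thesis
    by (simp add: real_le_lsqrt)
qed

subsection \<open>The inner product space of square-integrable functions\<close>

instantiation torus_L2 :: (finite, "{complex_hilbert, second_countable_topology}") complex_inner
begin

lift_definition zero_torus_L2 :: "('a, 'b) torus_L2" is "\<lambda>x. 0"
  by (simp add: torus_rel_def square_integrable_zero)

lift_definition plus_torus_L2 ::
  "('a, 'b) torus_L2 \<Rightarrow> ('a, 'b) torus_L2 \<Rightarrow> ('a, 'b) torus_L2" is "\<lambda>f g x. f x + g x"
  by (auto simp: torus_rel_def square_integrable_add elim: AE_mp)

lift_definition minus_torus_L2 ::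
  "('a, 'b) torus_L2 \<Rightarrow> ('a, 'b) torus_L2 \<Rightarrow> ('a, 'b) torus_L2" is "\<lambda>f g x. f x - g x"
  by (auto simp: torus_rel_def square_integrable_diff elim: AE_mp)

lift_definition uminus_torus_L2 :: "('a, 'b) torus_L2 \<Rightarrow> ('a, 'b) torus_L2" is "\<lambda>f x. - f x"
  by (auto simp: torus_rel_def square_integrable_uminus elim: AE_mp)

lift_definition scaleR_torus_L2 :: "real \<Rightarrow> ('a, 'b) torus_L2 \<Rightarrow> ('a, 'b) torus_L2"
  is "\<lambda>r f x. r *\<^sub>R f x"
  by (auto simp: torus_rel_def square_integrable_scaleR elim: AE_mp)

lift_definition scaleC_torus_L2 :: "complex \<Rightarrow> ('a, 'b) torus_L2 \<Rightarrow> ('a, 'b) torus_L2"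
  is "\<lambda>c f x. c *\<^sub>C f x"
  by (auto simp: torus_rel_def square_integrable_scaleC elim: AE_mp)

lift_definition cinner_torus_L2 :: "('a, 'b) torus_L2 \<Rightarrow> ('a, 'b) torus_L2 \<Rightarrow> complex"
  is "\<lambda>f g. LINT x|torus_measure. cinner (f x) (g x)"
proof -
  fix f f' g g' :: "real^'a \<Rightarrow> 'b"
  assume "torus_rel f f'" "torus_rel g g'"
  then show "(LINT x|torus_measure. cinner (f x) (g x)) = (LINT x|torus_measure. cinner (f' x) (g' x))"
    by (intro integral_cong_AE borel_measurable_cinner)
      (auto simp: torus_rel_def square_integrable_def)
qed

lift_definition norm_torus_L2 :: "('a, 'b) torus_L2 \<Rightarrow> real"
  is "\<lambda>f. sqrt (LINT x|torus_measure. (norm (f x))\<^sup>2)"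
proof -
  fix f g :: "real^'a \<Rightarrow> 'b"
  assume "torus_rel f g"
  then have "(LINT x|torus_measure. (norm (f x))\<^sup>2) = (LINT x|torus_measure. (norm (g x))\<^sup>2)"
    by (intro integral_cong_AE) (auto simp: torus_rel_def square_integrable_def)
  then show "sqrt (LINT x|torus_measure. (norm (f x))\<^sup>2) = sqrt (LINT x|torus_measure. (norm (g x))\<^sup>2)"
    by simp
qed

definition dist_torus_L2 :: "('a, 'b) torus_L2 \<Rightarrow> ('a, 'b) torus_L2 \<Rightarrow> real" where
  "dist_torus_L2 f g = norm (f - g)"

definition sgn_torus_L2 :: "('a, 'b) torus_L2 \<Rightarrow> ('a, 'b) torus_L2" where
  "sgn_torus_L2 f = inverse (norm f) *\<^sub>R f"

definition uniformity_torus_L2 :: "(('a, 'b) torus_L2 \<times> ('a, 'b) torus_L2) filter" where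
  "uniformity_torus_L2 = (INF e\<in>{0 <..}. principal {(f, g). dist f g < e})"

definition open_torus_L2 :: "('a, 'b) torus_L2 set \<Rightarrow> bool" where
  "open_torus_L2 S = (\<forall>f\<in>S. \<forall>\<^sub>F (f', g) in uniformity. f' = f \<longrightarrow> g \<in> S)"

instance
proof
  fix f g h :: "('a, 'b) torus_L2" and r s :: real and a b :: complex
  show "f + g + h = f + (g + h)"
    by transfer (simp add: torus_rel_def square_integrable_add add.assoc)
  show "f + g = g + f"
    by transfer (simp add: torus_rel_def square_integrable_add add.commute)
  show "0 + f = f"
    by transfer (simp add: torus_rel_def)
  show "- f + f = 0"
    by transfer (simp add: torus_rel_def square_integrable_zero)
  show "f - g = f + - g"
    by transfer (simp add: torus_rel_def square_integrable_diff)
  show "r *\<^sub>R (f + g) = r *\<^sub>R f + r *\<^sub>R g"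
    by transfer
      (use square_integrable_scaleR[OF square_integrable_add] in
        \<open>auto simp: torus_rel_def scaleR_add_right\<close>)
  show "(r + s) *\<^sub>R f = r *\<^sub>R f + s *\<^sub>R f"
    by transfer (use square_integrable_scaleR[of _ "_ + _"] in
        \<open>auto simp: torus_rel_def scaleR_add_left\<close>)
  show "r *\<^sub>R s *\<^sub>R f = (r * s) *\<^sub>R f"
    by transfer (simp add: torus_rel_def square_integrable_scaleR)
  show "1 *\<^sub>R f = f"
    by transfer (simp add: torus_rel_def)
  show "dist f g = norm (f - g)"
    by (rule dist_torus_L2_def)
  show "sgn f = inverse (norm f) *\<^sub>R f"
    by (rule sgn_torus_L2_def)
  show "uniformity = (INF e\<in>{0 <..}. principal {(x :: ('a, 'b) torus_L2, y). dist x y < e})"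
    by (rule uniformity_torus_L2_def)
  show "open U = (\<forall>x\<in>U. \<forall>\<^sub>F (x', y) in uniformity. x' = x \<longrightarrow> y \<in> U)"
    for U :: "('a, 'b) torus_L2 set"
    by (rule open_torus_L2_def)
  show "norm f = 0 \<longleftrightarrow> f = 0"
  proof transfer
    fix f :: "real^'a \<Rightarrow> 'b"
    assume f: "torus_rel f f"
    have "(LINT x|torus_measure. (norm (f x))\<^sup>2) = 0 \<longleftrightarrow> (AE x in torus_measure. (norm (f x))\<^sup>2 = 0)"
      using f by (intro integral_nonneg_eq_0_iff_AE) (auto simp: torus_rel_def square_integrable_def)
    then show "sqrt (LINT x|torus_measure. (norm (f x))\<^sup>2) = 0 \<longleftrightarrow> torus_rel f (\<lambda>x. 0)"
      using f by (simp add: torus_rel_def square_integrable_zero)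
  qed
  show "norm (f + g) \<le> norm f + norm g"
    by transfer (simp add: torus_rel_def sqrt_integral_norm_triangle)
  show "norm (r *\<^sub>R f) = \<bar>r\<bar> * norm f"
    by transfer (simp add: power_mult_distrib real_sqrt_mult)
  show "a *\<^sub>C (f + g) = a *\<^sub>C f + a *\<^sub>C g"
    by transfer
      (use square_integrable_scaleC[OF square_integrable_add] in
        \<open>auto simp: torus_rel_def scaleC_add_right\<close>)
  show "(a + b) *\<^sub>C f = a *\<^sub>C f + b *\<^sub>C f"
    by transfer (use square_integrable_scaleC[of _ "_ + _"] in
        \<open>auto simp: torus_rel_def scaleC_add_left\<close>)
  show "a *\<^sub>C b *\<^sub>C f = (a * b) *\<^sub>C f"
    by transfer (simp add: torus_rel_def square_integrable_scaleC scaleC_scaleC)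
  show "complex_of_real r *\<^sub>C f = r *\<^sub>R f"
    by transfer (simp add: torus_rel_def square_integrable_scaleR scaleC_of_real)
  show "cinner f g = cnj (cinner g f)"
  proof transfer
    fix f g :: "real^'a \<Rightarrow> 'b"
    show "(LINT x|torus_measure. cinner (f x) (g x)) = cnj (LINT x|torus_measure. cinner (g x) (f x))"
      by (subst cinner_commute) simp
  qed
  show "cinner (f + g) h = cinner f h + cinner g h"
    by transfer (simp add: torus_rel_def cinner_add_left integrable_cinner)
  show "cinner (a *\<^sub>C f) g = a * cinner f g"
    by transfer (simp add: cinner_scaleC_left)
  show "cinner f f = complex_of_real ((norm f)\<^sup>2)"
    by transfer (simp add: cinner_self del: of_real_power)
qed

end

section \<open>Fourier multipliers\<close>

text \<open>The inclusion of the integer lattice; \<open>|\<xi>|\<close> is the Euclidean norm.\<close>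

definition of_int_vec :: "int^'k \<Rightarrow> real^'k" where
  "of_int_vec \<xi> = (\<chi> i. real_of_int (\<xi> $ i))"

lift_definition fourier ::
  "('n::finite, 'h::{complex_hilbert, second_countable_topology}) torus_L2 \<Rightarrow> int^'n \<Rightarrow> 'h"
  is "\<lambda>f \<xi>. LINT x|torus_measure. cis (- 2 * pi * (x \<bullet> of_int_vec \<xi>)) *\<^sub>C f x"
proof
  fix f g :: "real^'n \<Rightarrow> 'h" and \<xi> :: "int^'n"
  assume fg: "torus_rel f g"
  have "continuous_on UNIV (\<lambda>x::real^'n. cis (- 2 * pi * (x \<bullet> of_int_vec \<xi>)))"
    by (intro continuous_intros)
  then have "(\<lambda>x::real^'n. cis (- 2 * pi * (x \<bullet> of_int_vec \<xi>))) \<in> borel_measurable torus_measure"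
    unfolding torus_measure_def
    by (intro measurable_restrict_space1) (auto intro: borel_measurable_continuous_onI)
  then show "(LINT x|torus_measure. cis (- 2 * pi * (x \<bullet> of_int_vec \<xi>)) *\<^sub>C f x)
      = (LINT x|torus_measure. cis (- 2 * pi * (x \<bullet> of_int_vec \<xi>)) *\<^sub>C g x)"
    using fg by (intro integral_cong_AE borel_measurable_scaleC)
      (auto simp: torus_rel_def square_integrable_def)
qed

text \<open>By the Riesz-Fischer theorem and the injectivity of the Fourier transform there is exactly
  one \<open>g\<close> below.\<close>

definition multiplier ::
  "(int^'n \<Rightarrow> ('h \<rightharpoonup> 'h))
    \<Rightarrow> (('n::finite, 'h::{complex_hilbert, second_countable_topology}) torus_L2
        \<rightharpoonup> ('n, 'h) torus_L2)" where
  "multiplier \<sigma> f =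
     (if (\<forall>\<xi>. fourier f \<xi> \<in> dom (\<sigma> \<xi>)) \<and>
         (\<lambda>\<xi>. (norm (the (\<sigma> \<xi> (fourier f \<xi>))))\<^sup>2) summable_on UNIV
      then Some (THE g. \<forall>\<xi>. fourier g \<xi> = the (\<sigma> \<xi> (fourier f \<xi>)))
      else None)"

definition elliptic ::
  "real \<Rightarrow> (int^'k \<Rightarrow> 'h::complex_hilbert) \<Rightarrow> (int^'n \<Rightarrow> ('h \<rightharpoonup> 'h)) \<Rightarrow> bool" where
  "elliptic m e \<sigma> \<longleftrightarrow>
     (\<exists>C>0. \<exists>C'>0. \<forall>t>0. \<forall>\<xi> \<alpha>.
        norm (exp_neg (adjoint_op (\<sigma> \<xi>) \<circ>\<^sub>m \<sigma> \<xi>) t (e \<alpha>))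
          \<le> C' * exp (- t * C * (1 + norm (of_int_vec \<alpha>) + norm (of_int_vec \<xi>)) powr m) \<and>
        norm (exp_neg (\<sigma> \<xi> \<circ>\<^sub>m adjoint_op (\<sigma> \<xi>)) t (e \<alpha>))
          \<le> C' * exp (- t * C * (1 + norm (of_int_vec \<alpha>) + norm (of_int_vec \<xi>)) powr m))"

end

theory Submission
  imports Defs
begin

text \<open>The Fourier transform decomposes \<open>A = T\<^sub>\<sigma>\<close> into the direct sum of the operators \<open>\<sigma>(\<xi>)\<close>. Thus
  \<open>f\<close> is in the kernel of \<open>A\<close> if and only if each Fourier coefficient of \<open>f\<close> is in the kernel
  of \<open>\<sigma>(\<xi>)\<close>, and the same holds for the kernels of the adjoints, which are the orthogonal
  complements of the ranges. Both kernels of the Fredholm operator \<open>A\<close> are finite-dimensional, so all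
  but finitely many summands vanish, and dimensions add up. The function \<open>x \<mapsto> e\<^sup>2\<^sup>\<pi>\<^sup>i\<^sup>x\<^sup>\<xi> h\<close> embeds
  \<open>\<sigma>(\<xi>)\<close> into \<open>A\<close>, from which \<open>\<sigma>(\<xi>)\<close> inherits the Fredholm property. The analytic input is the
  completeness of the Fourier system in \<open>L\<^sup>2\<close>.\<close>

section \<open>Fourier modes\<close>

text \<open>\<open>Ind\<close> sees an adjoint only through its kernel, so what has to pass between
  L2 and the coefficients is orthogonality: modes test a function coefficient by coefficient, and
  conversely coefficientwise orthogonality implies orthogonality
  (\<open>cinner_eq_0_if_fourier\<close>). The converse is where completeness enters; injectivity of
  the Fourier transform is a special case. The obstacle to completeness is that L2 lives on a
  half-open cube, which is not compact and whose opposite faces are not glued. Density is therefore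
  proved for functions of the point \<open>torus_map x\<close> of the compact torus in C^n, and a
  Borel inverse of \<open>torus_map\<close> on the cube brings it back. \<open>Ind\<close> is built
  on \<open>cdim\<close>, which is 0 on infinite-dimensional spaces, so dimensions may be added only
  once finiteness is known. For the cokernel, finiteness has to be carried over from a quotient to
  an orthogonal complement (\<open>cfinite_dim_orthogonal\<close>).\<close>

lemma space_torus_measure: "space torus_measure = {x::real^'n. \<forall>i. 0 \<le> x $ i \<and> x $ i < 1}"
  by (simp add: torus_measure_def space_restrict_space)

lemma fundamental_domain_borel: "{x::real^'n. \<forall>i. 0 \<le> x $ i \<and> x $ i < 1} \<in> sets borel"
proof -
  have "{x::real^'n. \<forall>i. 0 \<le> x $ i \<and> x $ i < 1} = (\<Inter>i. {x. 0 \<le> x $ i} \<inter> {x. x $ i < 1})"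
    by auto
  moreover have "{x::real^'n. 0 \<le> x $ i} \<in> sets borel" "{x::real^'n. x $ i < 1} \<in> sets borel" for i
    by (auto intro!: borel_closed borel_open closed_Collect_le open_Collect_less continuous_intros)
  ultimately show ?thesis
    by auto
qed

lemma borel_measurable_torus_measureI:
  "f \<in> borel_measurable borel \<Longrightarrow> f \<in> borel_measurable torus_measure"
  unfolding torus_measure_def by (intro measurable_restrict_space1) auto

text \<open>Fubini's theorem: \<open>lborel\<close> is the image of a product measure with one
  factor for each vector of \<open>Basis\<close>, and the indicator of the cube is the product of
  the indicators of half-open intervals.\<close>

lemma integral_torus_prod:
  fixes f :: "'n::finite \<Rightarrow> real \<Rightarrow> complex"
  assumes f: "\<And>i. continuous_on UNIV (f i)"
  shows "(LINT x|torus_measure. (\<Prod>i\<in>UNIV. f i (x $ i)))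
    = (\<Prod>i\<in>UNIV. LINT t|lborel. indicator {0..<1} t *\<^sub>R f i t)"
proof -
  interpret product_sigma_finite "\<lambda>_::real^'n. lborel :: real measure"
    by standard
  \<comment> \<open>\<open>u\<close> inverts \<open>\<lambda>i. axis i 1\<close>: the product
    measure is indexed by basis vectors, the factors \<open>f i\<close> by coordinates.\<close>
  define u where "u b = (SOME i. b = axis i (1::real))" for b :: "real^'n"
  define g where "g b t = indicator {0..<1} t *\<^sub>R f (u b) t" for b :: "real^'n" and t
  have u: "u (axis i 1) = i" for i
    unfolding u_def by (rule some_equality) (auto simp: axis_eq_axis)
  have bij: "bij_betw (\<lambda>i::'n. axis i (1::real)) UNIV Basis"
    by (auto simp: bij_betw_def Basis_vec_def inj_on_def axis_eq_axis)
  have bas: "(\<Prod>b\<in>Basis. h b) = (\<Prod>i\<in>UNIV. h (axis i 1))" for h :: "real^'n \<Rightarrow> complex"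
    by (rule prod.reindex_bij_betw[OF bij, symmetric])
  have meas: "(\<lambda>t. f i t) \<in> borel_measurable borel" for i
    using f by (rule borel_measurable_continuous_onI)
  have int: "integrable lborel (\<lambda>t. indicator {0..<1} t *\<^sub>R f i t)" for i
  proof -
    have "integrable lborel (\<lambda>t. indicator {0..1} t *\<^sub>R f i t)"
      using f by (intro borel_integrable_compact) (auto intro: continuous_on_subset)
    then have "set_integrable lborel {0..1} (f i)"
      by (simp add: set_integrable_def)
    then have "set_integrable lborel {0..<1} (f i)"
      by (rule set_integrable_subset) auto
    then show ?thesis
      by (simp add: set_integrable_def)
  qed
  have "(LINT x|torus_measure. (\<Prod>i\<in>UNIV. f i (x $ i)))
      = (LINT x|lborel. indicator {x::real^'n. \<forall>i. 0 \<le> x $ i \<and> x $ i < 1} x *\<^sub>R (\<Prod>i\<in>UNIV. f i (x $ i)))"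
    unfolding torus_measure_def using fundamental_domain_borel
    by (subst integral_restrict_space) (simp_all add: fundamental_domain_borel)
  also have "\<dots> = (LINT x|lborel. (\<Prod>b\<in>Basis. g b (x \<bullet> b)))"
  proof (rule Bochner_Integration.integral_cong[OF refl])
    fix x :: "real^'n"
    have "indicator {x::real^'n. \<forall>i. 0 \<le> x $ i \<and> x $ i < 1} x = (\<Prod>i\<in>UNIV. indicator {0..<1} (x $ i) :: real)"
    proof (cases "\<forall>i. 0 \<le> x $ i \<and> x $ i < 1")
      case False
      then have "\<exists>i\<in>UNIV. indicator {0..<1} (x $ i) = (0::real)"
        by (auto simp: indicator_def)
      then have "(\<Prod>i\<in>UNIV. indicator {0..<1} (x $ i) :: real) = 0"
        by (intro prod_zero) auto
      with False show ?thesis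
        by (simp del: prod_zero_iff)
    qed simp
    then show "indicator {x::real^'n. \<forall>i. 0 \<le> x $ i \<and> x $ i < 1} x *\<^sub>R (\<Prod>i\<in>UNIV. f i (x $ i))
        = (\<Prod>b\<in>Basis. g b (x \<bullet> b))"
      by (simp add: bas g_def u inner_axis scaleR_conv_of_real prod.distrib)
  qed
  also have "\<dots> = (LINT p|(\<Pi>\<^sub>M b\<in>Basis. lborel). (\<Prod>b\<in>Basis. g b ((\<Sum>b\<in>Basis. p b *\<^sub>R b) \<bullet> b)))"
  proof -
    have gm: "g b \<in> borel_measurable borel" for b
      unfolding g_def using meas by measurable
    have "(\<lambda>x. \<Prod>b\<in>Basis. g b (x \<bullet> b)) \<in> borel_measurable borel"
      by (intro borel_measurable_prod measurable_compose[OF _ gm]) measurable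
    moreover have "(\<lambda>p. \<Sum>b\<in>Basis. p b *\<^sub>R b)
        \<in> (\<Pi>\<^sub>M b\<in>(Basis :: (real^'n) set). lborel) \<rightarrow>\<^sub>M borel"
      by measurable
    ultimately show ?thesis
      by (subst lborel_eq) (rule integral_distr[rotated])
  qed
  also have "\<dots> = (LINT p|(\<Pi>\<^sub>M b\<in>Basis. lborel). (\<Prod>b\<in>Basis. g b (p b)))"
    by (intro Bochner_Integration.integral_cong refl prod.cong)
      (simp add: inner_sum_left inner_Basis if_distrib sum.delta cong: if_cong)
  also have "\<dots> = (\<Prod>b\<in>Basis. LINT t|lborel. g b t)"
    by (rule product_integral_prod) (auto simp: g_def int)
  finally show ?thesis
    by (simp add: bas g_def u)
qed

lemma integral_cis_unit_interval:
  "(LINT t|lborel. indicator {0..<1} t *\<^sub>R cis (2 * pi * (t * of_int k))) = (if k = 0 then 1 else 0)"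
proof -
  have cont: "continuous_on UNIV (\<lambda>t. cis (2 * pi * (t * of_int k)))"
    by (intro continuous_intros)
  \<comment> \<open>The endpoint 1 is a null set; the fundamental theorem of calculus is applied on
    the closed interval.\<close>
  have "(LINT t|lborel. indicator {0..<1::real} t *\<^sub>R cis (2 * pi * (t * of_int k)))
      = (LINT t|lborel. indicator {0..1} t *\<^sub>R cis (2 * pi * (t * of_int k)))"
  proof (rule integral_cong_AE)
    have "(\<lambda>t. cis (2 * pi * (t * of_int k))) \<in> borel_measurable lborel"
      using borel_measurable_continuous_onI[OF cont] by simp
    then show "(\<lambda>t. indicator {0..<1::real} t *\<^sub>R cis (2 * pi * (t * of_int k))) \<in> borel_measurable lborel"
      and "(\<lambda>t. indicator {0..1::real} t *\<^sub>R cis (2 * pi * (t * of_int k))) \<in> borel_measurable lborel"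
      by (simp_all add: borel_measurable_scaleR)
    show "AE t in lborel. indicator {0..<1::real} t *\<^sub>R cis (2 * pi * (t * of_int k))
        = indicator {0..1} t *\<^sub>R cis (2 * pi * (t * of_int k))"
      using AE_lborel_singleton[of "1::real"] by eventually_elim (auto simp: indicator_def)
  qed
  also have "\<dots> = (if k = 0 then 1 else 0)"
  proof (cases "k = 0")
    case False
    define c where "c = \<i> * of_real (2 * pi * of_int k)"
    have c: "c \<noteq> 0"
      using False by (simp add: c_def)
    have cis: "cis (2 * pi * (t * of_int k)) = exp (c * of_real t)" for t
      by (simp add: cis_conv_exp c_def mult_ac)
    have "(LINT t|lborel. indicator {0..1} t *\<^sub>R cis (2 * pi * (t * of_int k)))
        = exp (c * of_real 1) / c - exp (c * of_real 0) / c"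
    proof (rule integral_FTC_Icc)
      fix t :: real
      have "((\<lambda>z. exp (c * z) / c) has_field_derivative exp (c * of_real t)) (at (of_real t))"
        using c by (auto intro!: derivative_eq_intros)
      then show "((\<lambda>t. exp (c * of_real t) / c) has_vector_derivative cis (2 * pi * (t * of_int k)))
          (at t within {0..1})"
        unfolding cis by (rule has_vector_derivative_real_field)
      show "continuous_on {0..1} (\<lambda>t. cis (2 * pi * (t * of_int k)))"
        using cont by (rule continuous_on_subset) simp
    qed simp
    also have "exp (c * of_real 1) = 1"
      using cis[of 1] cis_multiple_2pi[of "of_int k"] by simp
    finally show ?thesis
      using False by simp
  qed simp
  finally show ?thesis .
qed

lemma inner_of_int_vec: "x \<bullet> of_int_vec \<xi> = (\<Sum>i\<in>UNIV. x $ i * of_int (\<xi> $ i))"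
  by (simp add: inner_vec_def of_int_vec_def)

lemma of_int_vec_add: "of_int_vec (\<xi> + \<eta>) = of_int_vec \<xi> + of_int_vec \<eta>"
  and of_int_vec_diff: "of_int_vec (\<xi> - \<eta>) = of_int_vec \<xi> - of_int_vec \<eta>"
  and of_int_vec_0: "of_int_vec 0 = 0"
  by (simp_all add: of_int_vec_def vec_eq_iff)

lemma cis_sum: "finite A \<Longrightarrow> cis (\<Sum>i\<in>A. f i) = (\<Prod>i\<in>A. cis (f i))"
  by (induction A rule: finite_induct) (simp_all add: cis_mult[symmetric])

lemma integral_torus_character:
  "(LINT x|torus_measure. cis (2 * pi * (x \<bullet> of_int_vec \<xi>))) = (if \<xi> = 0 then 1 else 0)"
proof -
  have "(LINT x|torus_measure. cis (2 * pi * (x \<bullet> of_int_vec \<xi>)))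
      = (LINT x|torus_measure. (\<Prod>i\<in>UNIV. cis (2 * pi * (x $ i * of_int (\<xi> $ i)))))"
    by (simp add: inner_of_int_vec sum_distrib_left cis_sum)
  also have "\<dots> = (\<Prod>i\<in>UNIV. LINT t|lborel. indicator {0..<1} t *\<^sub>R cis (2 * pi * (t * of_int (\<xi> $ i))))"
    by (rule integral_torus_prod) (intro continuous_intros)
  also have "\<dots> = (if \<xi> = 0 then 1 else 0)"
    by (auto simp: integral_cis_unit_interval vec_eq_iff)
  finally show ?thesis .
qed

lemma finite_measure_torus: "finite_measure (torus_measure :: (real^'n) measure)"
proof
  have "emeasure lborel {x::real^'n. \<forall>i. 0 \<le> x $ i \<and> x $ i < 1} \<le> emeasure lborel (cbox 0 (1::real^'n))"
    by (rule emeasure_mono) (auto simp: mem_box_cart less_imp_le)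
  also have "\<dots> < \<infinity>"
    by (rule emeasure_lborel_cbox_finite)
  finally show "emeasure (torus_measure :: (real^'n) measure) (space torus_measure) \<noteq> \<infinity>"
    using fundamental_domain_borel
    by (simp add: space_torus_measure torus_measure_def emeasure_restrict_space fundamental_domain_borel)
qed

lemma square_integrable_bounded:
  fixes f :: "real^'n \<Rightarrow> 'h::{complex_hilbert, second_countable_topology}"
  assumes "f \<in> borel_measurable torus_measure" and B: "\<And>x. norm (f x) \<le> B"
  shows "square_integrable f"
proof -
  interpret finite_measure "torus_measure :: (real^'n) measure"
    by (rule finite_measure_torus)
  have "(norm (f x))\<^sup>2 \<le> B\<^sup>2" for x
    using B by (intro power_mono) auto
  then have "integrable torus_measure (\<lambda>x. (norm (f x))\<^sup>2)"
    using assms by (intro integrable_const_bound[where B="B\<^sup>2"]) auto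
  then show ?thesis
    using assms by (simp add: square_integrable_def)
qed

text \<open>The bound \<open>norm (f x) \<le> 1 + (norm (f x))\<^sup>2\<close> is integrable because
  the measure is finite. It makes the integrals that define \<open>fourier\<close> genuine ones, so
  that an inner product with a fixed vector can be moved inside.\<close>

lemma square_integrable_imp_integrable:
  fixes f :: "real^'n \<Rightarrow> 'h::{complex_hilbert, second_countable_topology}"
  assumes "square_integrable f"
  shows "integrable torus_measure f"
proof (rule Bochner_Integration.integrable_bound)
  interpret finite_measure "torus_measure :: (real^'n) measure"
    by (rule finite_measure_torus)
  show "integrable torus_measure (\<lambda>x. 1 + (norm (f x))\<^sup>2)"
    using assms by (intro Bochner_Integration.integrable_add integrable_const)
      (simp add: square_integrable_def)
  show "f \<in> borel_measurable torus_measure"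
    using assms by (simp add: square_integrable_def)
  show "AE x in torus_measure. norm (f x) \<le> norm (1 + (norm (f x))\<^sup>2)"
  proof (rule AE_I2)
    fix x
    have "2 * norm (f x) \<le> 1 + (norm (f x))\<^sup>2"
      using zero_le_power2[of "norm (f x) - 1"] by (simp add: power2_diff)
    then have "norm (f x) \<le> 1 + (norm (f x))\<^sup>2"
      using norm_ge_zero[of "f x"] by linarith
    then show "norm (f x) \<le> norm (1 + (norm (f x))\<^sup>2)"
      unfolding real_norm_def by linarith
  qed
qed

section \<open>Single-frequency functions and Fourier coefficients\<close>

lemma borel_measurable_character:
  "(\<lambda>x. cis (2 * pi * (x \<bullet> of_int_vec \<xi>))) \<in> borel_measurable torus_measure"
  by (intro borel_measurable_torus_measureI borel_measurable_continuous_onI continuous_intros)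

lemma square_integrable_mode:
  fixes h :: "'h::{complex_hilbert, second_countable_topology}"
  shows "square_integrable (\<lambda>x. cis (2 * pi * (x \<bullet> of_int_vec \<xi>)) *\<^sub>C h)"
  by (rule square_integrable_bounded[where B="norm h"])
    (auto intro: borel_measurable_scaleC borel_measurable_character simp: norm_scaleC)

lift_definition fourier_mode ::
  "int^'n::finite \<Rightarrow> 'h::{complex_hilbert, second_countable_topology} \<Rightarrow> ('n, 'h) torus_L2"
  is "\<lambda>\<xi> h x. cis (2 * pi * (x \<bullet> of_int_vec \<xi>)) *\<^sub>C h"
  by (simp add: torus_rel_def square_integrable_mode)

lemma fourier_mode_add:
  fixes h h' :: "'h::{complex_hilbert, second_countable_topology}" and \<xi> :: "int^'n::finite"
  shows "fourier_mode \<xi> (h + h') = fourier_mode \<xi> h + fourier_mode \<xi> h'"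
proof transfer
  fix \<xi> :: "int^'n" and h h' :: 'h
  show "torus_rel (\<lambda>x. cis (2 * pi * (x \<bullet> of_int_vec \<xi>)) *\<^sub>C (h + h'))
     (\<lambda>x. cis (2 * pi * (x \<bullet> of_int_vec \<xi>)) *\<^sub>C h + cis (2 * pi * (x \<bullet> of_int_vec \<xi>)) *\<^sub>C h')"
    using square_integrable_mode[of \<xi> "h + h'"] by (simp add: torus_rel_def scaleC_add_right)
qed

lemma fourier_mode_scaleC:
  fixes h :: "'h::{complex_hilbert, second_countable_topology}" and \<xi> :: "int^'n::finite"
  shows "fourier_mode \<xi> (c *\<^sub>C h) = c *\<^sub>C fourier_mode \<xi> h"
proof transfer
  fix \<xi> :: "int^'n" and h :: 'h and c
  show "torus_rel (\<lambda>x. cis (2 * pi * (x \<bullet> of_int_vec \<xi>)) *\<^sub>C c *\<^sub>C h)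
     (\<lambda>x. c *\<^sub>C cis (2 * pi * (x \<bullet> of_int_vec \<xi>)) *\<^sub>C h)"
    using square_integrable_mode[of \<xi> "c *\<^sub>C h"] by (simp add: torus_rel_def scaleC_scaleC mult.commute)
qed

lemma bounded_linear_cinner_left: "bounded_linear (\<lambda>x. cinner x (y::'a::complex_inner))"
  by (rule bounded_bilinear.bounded_linear_left[OF bounded_bilinear_cinner])

text \<open>A character is conjugated when it moves to the other side of the inner product, so the
  mode embedding and the coefficient map are adjoint to each other. Linearity of
  \<open>fourier\<close> and its values on modes are deduced from this without returning to
  integrals.\<close>

lemma cinner_fourier_mode:
  fixes h :: "'h::{complex_hilbert, second_countable_topology}" and \<xi> :: "int^'n::finite"
  shows "cinner f (fourier_mode \<xi> h) = cinner (fourier f \<xi>) h"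
proof transfer
  fix f :: "real^'n \<Rightarrow> 'h" and \<xi> :: "int^'n" and h :: 'h
  assume "torus_rel f f"
  then have f: "square_integrable f" by (simp add: torus_rel_def)
  have cis: "cnj (cis (2 * pi * (x \<bullet> of_int_vec \<xi>))) = cis (- 2 * pi * (x \<bullet> of_int_vec \<xi>))" for x
    by (simp add: cis_cnj)
  have "(\<lambda>x. cnj (cis (2 * pi * (x \<bullet> of_int_vec \<xi>)))) \<in> borel_measurable torus_measure"
    by (intro borel_measurable_torus_measureI borel_measurable_continuous_onI continuous_intros)
  then have m: "(\<lambda>x. cis (- 2 * pi * (x \<bullet> of_int_vec \<xi>)) *\<^sub>C f x) \<in> borel_measurable torus_measure"
    unfolding cis using f by (intro borel_measurable_scaleC) (auto simp: square_integrable_def)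
  then have i: "integrable torus_measure (\<lambda>x. cis (- 2 * pi * (x \<bullet> of_int_vec \<xi>)) *\<^sub>C f x)"
    by (rule Bochner_Integration.integrable_bound[OF square_integrable_imp_integrable[OF f]])
      (simp add: norm_scaleC)
  have "(LINT x|torus_measure. cinner (f x) (cis (2 * pi * (x \<bullet> of_int_vec \<xi>)) *\<^sub>C h))
      = (LINT x|torus_measure. cinner (cis (- 2 * pi * (x \<bullet> of_int_vec \<xi>)) *\<^sub>C f x) h)"
    by (simp only: cinner_scaleC_right cinner_scaleC_left cis)
  also have "\<dots> = cinner (LINT x|torus_measure. cis (- 2 * pi * (x \<bullet> of_int_vec \<xi>)) *\<^sub>C f x) h"
    by (rule integral_bounded_linear[OF bounded_linear_cinner_left i])
  finally show "(LINT x|torus_measure. cinner (f x) (cis (2 * pi * (x \<bullet> of_int_vec \<xi>)) *\<^sub>C h))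
      = cinner (LINT x|torus_measure. cis (- 2 * pi * (x \<bullet> of_int_vec \<xi>)) *\<^sub>C f x) h" .
qed

lemma cinner_fourier_modes:
  fixes h h' :: "'h::{complex_hilbert, second_countable_topology}" and \<xi> \<eta> :: "int^'n::finite"
  shows "cinner (fourier_mode \<xi> h) (fourier_mode \<eta> h') = (if \<xi> = \<eta> then cinner h h' else 0)"
proof -
  have cis: "cis (2 * pi * (x \<bullet> of_int_vec \<xi>)) * cnj (cis (2 * pi * (x \<bullet> of_int_vec \<eta>)))
      = cis (2 * pi * (x \<bullet> of_int_vec (\<xi> - \<eta>)))" for x :: "real^'n"
    unfolding cis_cnj cis_mult of_int_vec_diff inner_diff_right right_diff_distrib by simp
  have "cinner (fourier_mode \<xi> h) (fourier_mode \<eta> h')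
      = (LINT x|torus_measure. cinner (cis (2 * pi * (x \<bullet> of_int_vec \<xi>)) *\<^sub>C h)
          (cis (2 * pi * (x \<bullet> of_int_vec \<eta>)) *\<^sub>C h'))"
    by transfer (rule refl)
  also have "\<dots> = (LINT x|torus_measure. cis (2 * pi * (x \<bullet> of_int_vec (\<xi> - \<eta>))) * cinner h h')"
  proof -
    have "cinner (cis (2 * pi * (x \<bullet> of_int_vec \<xi>)) *\<^sub>C h) (cis (2 * pi * (x \<bullet> of_int_vec \<eta>)) *\<^sub>C h')
        = cis (2 * pi * (x \<bullet> of_int_vec (\<xi> - \<eta>))) * cinner h h'" for x :: "real^'n"
      unfolding cinner_scaleC_left cinner_scaleC_right cis[symmetric] by (simp only: mult_ac)
    then show ?thesis
      by (rule Bochner_Integration.integral_cong[OF refl])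
  qed
  also have "\<dots> = (LINT x|torus_measure. cis (2 * pi * (x \<bullet> of_int_vec (\<xi> - \<eta>)))) * cinner h h'"
    by (rule integral_mult_left_zero)
  finally show ?thesis
    unfolding integral_torus_character by simp
qed

lemma cinner_eqI: "(\<And>z. cinner x z = cinner y z) \<Longrightarrow> x = (y::'a::complex_inner)"
proof -
  assume *: "\<And>z. cinner x z = cinner y z"
  have "cinner (x - y) z + cinner y z = cinner x z" for z
    by (simp add: cinner_add_left[symmetric])
  then have "cinner (x - y) (x - y) = 0"
    using * by (metis add_0 add_right_cancel)
  then show "x = y"
    by (simp add: cinner_self)
qed

lemma cinner_0_left [simp]: "cinner 0 (x::'a::complex_inner) = 0"
  and cinner_0_right [simp]: "cinner (x::'a::complex_inner) 0 = 0"
  using bounded_bilinear.zero_left[OF bounded_bilinear_cinner]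
    bounded_bilinear.zero_right[OF bounded_bilinear_cinner] by auto

lemma fourier_fourier_mode: "fourier (fourier_mode \<xi> h) \<eta> = (if \<xi> = \<eta> then h else 0)"
  by (rule cinner_eqI) (simp add: cinner_fourier_mode[symmetric] cinner_fourier_modes)

lemma fourier_add: "fourier (f + g) \<xi> = fourier f \<xi> + fourier g \<xi>"
  by (rule cinner_eqI) (simp add: cinner_add_left cinner_fourier_mode[symmetric])

lemma fourier_scaleC: "fourier (c *\<^sub>C f) \<xi> = c *\<^sub>C fourier f \<xi>"
  by (rule cinner_eqI) (simp add: cinner_scaleC_left cinner_fourier_mode[symmetric])

lemma norm_fourier_mode: "norm (fourier_mode \<xi> h) = norm h"
proof -
  have "complex_of_real ((norm (fourier_mode \<xi> h))\<^sup>2) = complex_of_real ((norm h)\<^sup>2)"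
    unfolding cinner_self[symmetric] by (simp add: cinner_fourier_modes)
  then show ?thesis
    by (simp only: of_real_eq_iff) (simp add: power2_eq_iff_nonneg)
qed

section \<open>Density of the trigonometric polynomials\<close>

text \<open>Only sums are built in; closure under products follows because frequencies add. Finite
  sums of characters are what a vector factor turns into elements of
  \<open>trig_span\<close>.\<close>

inductive trig_poly :: "(real^'n::finite \<Rightarrow> complex) \<Rightarrow> bool" where
  character: "trig_poly (\<lambda>x. c * cis (2 * pi * (x \<bullet> of_int_vec \<xi>)))"
| add: "trig_poly p \<Longrightarrow> trig_poly q \<Longrightarrow> trig_poly (\<lambda>x. p x + q x)"

lemma trig_poly_const: "trig_poly (\<lambda>x. c)"
  using trig_poly.character[of c 0] by (simp add: of_int_vec_0)

lemma trig_poly_mult: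
  assumes "trig_poly p" "trig_poly q"
  shows "trig_poly (\<lambda>x. p x * q x)"
  using assms
proof (induction p)
  case (character c \<xi>)
  from character show ?case
  proof (induction q)
    case (character d \<eta>)
    have "c * cis (2 * pi * (x \<bullet> of_int_vec \<xi>)) * (d * cis (2 * pi * (x \<bullet> of_int_vec \<eta>)))
        = c * d * cis (2 * pi * (x \<bullet> of_int_vec (\<xi> + \<eta>)))" for x
    proof -
      have "cis (2 * pi * (x \<bullet> of_int_vec (\<xi> + \<eta>)))
          = cis (2 * pi * (x \<bullet> of_int_vec \<xi>)) * cis (2 * pi * (x \<bullet> of_int_vec \<eta>))"
        unfolding cis_mult of_int_vec_add inner_add_right distrib_left ..
      then show ?thesis
        by (simp only: mult_ac)
    qed
    then show ?case
      using trig_poly.character[of "c * d" "\<xi> + \<eta>"] by (simp only:)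
  next
    case (add p q)
    then show ?case
      unfolding distrib_left by (intro trig_poly.add) auto
  qed
next
  case (add p p')
  then show ?case
    unfolding distrib_right by (intro trig_poly.add) auto
qed

text \<open>Lifting asks for a total map, so functions that are not square integrable go to the zero
  class. Limit arguments can then be carried out with representatives.\<close>

lift_definition to_L2 ::
  "(real^'n::finite \<Rightarrow> 'h::{complex_hilbert, second_countable_topology}) \<Rightarrow> ('n, 'h) torus_L2"
  is "\<lambda>f. if square_integrable f then f else (\<lambda>_. 0)"
  by (simp add: torus_rel_def square_integrable_zero)

lemma to_L2_surj:
  fixes F :: "('n::finite, 'h::{complex_hilbert, second_countable_topology}) torus_L2"
  obtains f where "square_integrable f" "F = to_L2 f"
proof -
  have "\<exists>f. square_integrable f \<and> F = to_L2 f"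
    by transfer (auto simp: torus_rel_def)
  then show ?thesis
    using that by blast
qed

lemma to_L2_zero: "to_L2 (\<lambda>_. 0) = 0"
  by transfer (simp add: torus_rel_def square_integrable_zero)

context
  fixes f g :: "real^'n::finite \<Rightarrow> 'h::{complex_hilbert, second_countable_topology}"
  assumes f: "square_integrable f" and g: "square_integrable g"
begin

lemma to_L2_add: "to_L2 (\<lambda>x. f x + g x) = to_L2 f + to_L2 g"
  using f g by transfer (simp add: torus_rel_def square_integrable_add)

lemma to_L2_diff: "to_L2 (\<lambda>x. f x - g x) = to_L2 f - to_L2 g"
  using f g by transfer (simp add: torus_rel_def square_integrable_diff)

lemma dist_to_L2: "dist (to_L2 f) (to_L2 g) = sqrt (LINT x|torus_measure. (norm (f x - g x))\<^sup>2)"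
  using f g unfolding dist_norm by transfer simp

lemma to_L2_eqI:
  assumes "\<And>x. x \<in> space torus_measure \<Longrightarrow> f x = g x"
  shows "to_L2 f = to_L2 g"
proof -
  have "dist (to_L2 f) (to_L2 g) = sqrt (LINT x|(torus_measure :: (real^'n) measure). 0)"
    unfolding dist_to_L2 using assms
    by (intro arg_cong[where f=sqrt] Bochner_Integration.integral_cong) auto
  then show ?thesis
    by simp
qed

end

text \<open>The limit inherits the majorant \<open>w\<close>, so \<open>norm (F i x - f x)\<close>
  is at most \<open>2 * w x\<close>, and the scalar dominated convergence theorem applies to the
  squares. Every limit on the way to density is an instance of this lemma.\<close>

lemma to_L2_dominated_convergence:
  fixes F :: "nat \<Rightarrow> real^'n::finite \<Rightarrow> 'h::{complex_hilbert, second_countable_topology}"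
  assumes F: "\<And>i. square_integrable (F i)" and f: "square_integrable f"
    and w: "integrable torus_measure (\<lambda>x. (w x)\<^sup>2)"
    and lim: "\<And>x. x \<in> space torus_measure \<Longrightarrow> (\<lambda>i. F i x) \<longlonglongrightarrow> f x"
    and bound: "\<And>i x. x \<in> space torus_measure \<Longrightarrow> norm (F i x) \<le> w x"
  shows "(\<lambda>i. to_L2 (F i)) \<longlonglongrightarrow> to_L2 f"
proof -
  have fb: "norm (f x) \<le> w x" if "x \<in> space torus_measure" for x
    using bound[OF that] by (intro tendsto_upperbound[OF tendsto_norm[OF lim[OF that]]]) auto
  have "(\<lambda>i. LINT x|torus_measure. (norm (F i x - f x))\<^sup>2) \<longlonglongrightarrow> (LINT x|(torus_measure :: (real^'n) measure). 0)"
  proof (rule integral_dominated_convergence)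
    show "integrable torus_measure (\<lambda>x. (2 * w x)\<^sup>2)"
      using w by (simp add: power_mult_distrib)
    show "(\<lambda>x. (norm (F i x - f x))\<^sup>2) \<in> borel_measurable torus_measure" for i
      using square_integrable_diff[OF F[of i] f]
      by (simp add: square_integrable_def borel_measurable_integrable)
    show "AE x in torus_measure. (\<lambda>i. (norm (F i x - f x))\<^sup>2) \<longlonglongrightarrow> 0"
    proof (rule AE_I2)
      fix x :: "real^'n"
      assume "x \<in> space torus_measure"
      from tendsto_power[OF tendsto_norm[OF tendsto_diff[OF lim[OF this] tendsto_const[of "f x"]]], of 2]
      show "(\<lambda>i. (norm (F i x - f x))\<^sup>2) \<longlonglongrightarrow> 0"
        by simp
    qed
    show "AE x in torus_measure. norm ((norm (F i x - f x))\<^sup>2) \<le> (2 * w x)\<^sup>2" for i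
    proof (rule AE_I2)
      fix x :: "real^'n"
      assume x: "x \<in> space torus_measure"
      have "norm (F i x - f x) \<le> 2 * w x"
        using norm_triangle_ineq4[of "F i x" "f x"] bound[OF x, of i] fb[OF x] by linarith
      then have "(norm (F i x - f x))\<^sup>2 \<le> (2 * w x)\<^sup>2"
        by (intro power_mono) auto
      then show "norm ((norm (F i x - f x))\<^sup>2) \<le> (2 * w x)\<^sup>2"
        by simp
    qed
  qed simp
  then have "(\<lambda>i. sqrt (LINT x|torus_measure. (norm (F i x - f x))\<^sup>2)) \<longlonglongrightarrow> sqrt 0"
    by (intro tendsto_real_sqrt) simp
  then show ?thesis
    unfolding tendsto_dist_iff[of _ "to_L2 f"] by (simp add: dist_to_L2 F f)
qed

definition trig_span :: "('n::finite, 'h::{complex_hilbert, second_countable_topology}) torus_L2 set" where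
  "trig_span = cspan (\<Union>\<xi>. range (fourier_mode \<xi>))"

lemma trig_poly_in_trig_span:
  fixes h :: "'h::{complex_hilbert, second_countable_topology}"
  assumes "trig_poly p"
  shows "square_integrable (\<lambda>x. p x *\<^sub>C h) \<and> to_L2 (\<lambda>x. p x *\<^sub>C h) \<in> trig_span"
  using assms
proof induction
  case (character c \<xi>)
  have eq: "(\<lambda>x. (c * cis (2 * pi * (x \<bullet> of_int_vec \<xi>))) *\<^sub>C h)
      = (\<lambda>x. cis (2 * pi * (x \<bullet> of_int_vec \<xi>)) *\<^sub>C (c *\<^sub>C h))"
    by (simp add: scaleC_scaleC mult.commute)
  have "to_L2 (\<lambda>x. cis (2 * pi * (x \<bullet> of_int_vec \<xi>)) *\<^sub>C (c *\<^sub>C h)) = fourier_mode \<xi> (c *\<^sub>C h)"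
    using square_integrable_mode[of \<xi> "c *\<^sub>C h"] by transfer (simp only: torus_rel_def if_True simp_thms, simp)
  moreover have "fourier_mode \<xi> (c *\<^sub>C h) \<in> trig_span"
    unfolding trig_span_def by (intro complex_vector.span_base) blast
  ultimately show ?case
    unfolding eq using square_integrable_mode[of \<xi> "c *\<^sub>C h"] by metis
next
  case (add p q)
  then show ?case
    by (auto simp: scaleC_add_left square_integrable_add to_L2_add trig_span_def
        intro: complex_vector.span_add)
qed

lemma csubspace_closure:
  fixes V :: "'a::complex_inner set"
  assumes "csubspace V"
  shows "csubspace (closure V)"
proof (rule complex_vector.subspaceI)
  show "0 \<in> closure V"
    using complex_vector.subspace_0[OF assms] closure_subset by blast
next
  fix x y assume "x \<in> closure V" "y \<in> closure V"
  then obtain X Y where "\<And>n. X n \<in> V" "X \<longlonglongrightarrow> x" "\<And>n. Y n \<in> V" "Y \<longlonglongrightarrow> y"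
    unfolding closure_sequential by blast
  then show "x + y \<in> closure V"
    unfolding closure_sequential using complex_vector.subspace_add[OF assms]
    by (intro exI[of _ "\<lambda>n. X n + Y n"]) (auto intro: tendsto_add)
next
  fix c x assume "x \<in> closure V"
  then obtain X where "\<And>n. X n \<in> V" "X \<longlonglongrightarrow> x"
    unfolding closure_sequential by blast
  then show "c *\<^sub>C x \<in> closure V"
    unfolding closure_sequential using complex_vector.subspace_scale[OF assms]
    by (intro exI[of _ "\<lambda>n. c *\<^sub>C X n"]) (auto intro: bounded_linear.tendsto[OF bounded_linear_scaleC])
qed

lemma csubspace_closure_trig_span: "csubspace (closure trig_span)"
  unfolding trig_span_def by (intro csubspace_closure complex_vector.subspace_span)

section \<open>Passage from the cube to the compact torus\<close>

definition torus_map :: "real^'n \<Rightarrow> complex^'n" where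
  "torus_map x = (\<chi> i. cis (2 * pi * x $ i))"

lemma continuous_on_torus_map: "continuous_on S torus_map"
  unfolding torus_map_def by (intro continuous_intros)

lemma borel_measurable_torus_map: "torus_map \<in> borel_measurable torus_measure"
  by (intro borel_measurable_torus_measureI borel_measurable_continuous_onI continuous_on_torus_map)

lemma compact_torus: "compact {z::complex^'n::finite. \<forall>i. norm (z $ i) = 1}"
proof -
  have "norm z \<le> of_nat CARD('n)" if "\<forall>i. norm (z $ i) = 1" for z :: "complex^'n"
    using that L2_set_le_sum[of UNIV "\<lambda>i. norm (z $ i)"] by (simp add: norm_vec_def)
  then have "bounded {z::complex^'n. \<forall>i. norm (z $ i) = 1}"
    unfolding bounded_iff by blast
  moreover have "{z::complex^'n. \<forall>i. norm (z $ i) = 1} = (\<Inter>i. {z. norm (z $ i) = 1})"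
    by auto
  then have "closed {z::complex^'n. \<forall>i. norm (z $ i) = 1}"
    by (auto intro!: closed_INT closed_Collect_eq continuous_intros)
  ultimately show ?thesis
    by (simp add: compact_eq_bounded_closed)
qed

text \<open>Functions on the torus are transported to the compact set of all points with unimodular
  coordinates, where the trigonometric polynomials separate points.\<close>

lemma trig_poly_uniformly_dense:
  fixes \<phi> :: "complex^'n::finite \<Rightarrow> real"
  assumes "continuous_on UNIV \<phi>" "\<epsilon> > 0"
  obtains p where "trig_poly (\<lambda>x. complex_of_real (p x))" "\<And>x. \<bar>\<phi> (torus_map x) - p x\<bar> < \<epsilon>"
proof -
  let ?T = "{z::complex^'n. \<forall>i. norm (z $ i) = 1}"
  \<comment> \<open>Stone-Weierstrass is applied in its real form: members of \<open>?R\<close> are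
    real functions continuous on the torus, while their pullbacks to the cube are complex
    trigonometric polynomials. Real and imaginary parts of the coordinates belong to
    \<open>?R\<close> and separate points.\<close>
  let ?R = "{u. continuous_on ?T u \<and> trig_poly (\<lambda>x. complex_of_real (u (torus_map x)))}"
  \<comment> \<open>Coordinate exponentials are characters whose frequencies are plus or minus unit
    vectors; the factor 1 gives them the shape of the rule
    \<open>trig_poly.character\<close>.\<close>
  have char: "cis (2 * pi * x $ i) = 1 * cis (2 * pi * (x \<bullet> of_int_vec (axis i 1)))"
    "cis (- (2 * pi * x $ i)) = 1 * cis (2 * pi * (x \<bullet> of_int_vec (axis i (-1))))"
    for x :: "real^'n" and i
  proof -
    have "of_int_vec (axis i 1) = (axis i 1 :: real^'n)" "of_int_vec (axis i (-1)) = (axis i (-1) :: real^'n)"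
      by (simp_all add: of_int_vec_def axis_def vec_eq_iff)
    then show "cis (2 * pi * x $ i) = 1 * cis (2 * pi * (x \<bullet> of_int_vec (axis i 1)))"
      "cis (- (2 * pi * x $ i)) = 1 * cis (2 * pi * (x \<bullet> of_int_vec (axis i (-1))))"
      by (simp_all add: inner_axis)
  qed
  have tp: "trig_poly (\<lambda>x. cis (2 * pi * x $ i))" "trig_poly (\<lambda>x. cis (- (2 * pi * x $ i)))" for i :: 'n
    unfolding char by (rule trig_poly.character)+
  have re: "(\<lambda>z. Re (z $ i)) \<in> ?R" for i
  proof -
    have "complex_of_real (Re (torus_map x $ i))
        = 1 / 2 * cis (2 * pi * x $ i) + 1 / 2 * cis (- (2 * pi * x $ i))" for x :: "real^'n"
      by (simp add: torus_map_def complex_eq_iff)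
    moreover have "trig_poly (\<lambda>x. 1 / 2 * cis (2 * pi * x $ i) + 1 / 2 * cis (- (2 * pi * x $ i)))"
      by (intro trig_poly.add trig_poly_mult[OF trig_poly_const] tp)
    ultimately have "trig_poly (\<lambda>x. complex_of_real (Re (torus_map x $ i)))"
      by (simp only:)
    then show ?thesis
      by (auto intro!: continuous_intros)
  qed
  have im: "(\<lambda>z. Im (z $ i)) \<in> ?R" for i
  proof -
    have "complex_of_real (Im (torus_map x $ i))
        = - \<i> / 2 * cis (2 * pi * x $ i) + \<i> / 2 * cis (- (2 * pi * x $ i))" for x :: "real^'n"
      by (simp add: torus_map_def complex_eq_iff)
    moreover have "trig_poly (\<lambda>x. - \<i> / 2 * cis (2 * pi * x $ i) + \<i> / 2 * cis (- (2 * pi * x $ i)))"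
      by (intro trig_poly.add trig_poly_mult[OF trig_poly_const] tp)
    ultimately have "trig_poly (\<lambda>x. complex_of_real (Im (torus_map x $ i)))"
      by (simp only:)
    then show ?thesis
      by (auto intro!: continuous_intros)
  qed
  interpret function_ring_on ?R ?T
  proof
    fix z w :: "complex^'n"
    assume "z \<noteq> w"
    then obtain i where "z $ i \<noteq> w $ i"
      by (auto simp: vec_eq_iff)
    then have "Re (z $ i) \<noteq> Re (w $ i) \<or> Im (z $ i) \<noteq> Im (w $ i)"
      by (simp add: complex_eq_iff)
    then show "\<exists>u\<in>?R. u z \<noteq> u w"
      by (elim disjE) (rule bexI[OF _ re] bexI[OF _ im], assumption)+
  qed (auto simp: compact_torus trig_poly_const intro: continuous_intros trig_poly.add trig_poly_mult)
  have "continuous_on ?T \<phi>"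
    using assms(1) by (rule continuous_on_subset) simp
  from Stone_Weierstrass_basic[OF this assms(2)] obtain u
    where u: "u \<in> ?R" "\<forall>z\<in>?T. \<bar>\<phi> z - u z\<bar> < \<epsilon>"
    by blast
  moreover have "torus_map x \<in> ?T" for x :: "real^'n"
    by (simp add: torus_map_def)
  ultimately show ?thesis
    by (intro that[of "\<lambda>x. u (torus_map x)"]) auto
qed

text \<open>Uniform approximation implies approximation in L2 because the measure is finite.\<close>

lemma continuous_in_closure_trig_span:
  fixes h :: "'h::{complex_hilbert, second_countable_topology}"
    and \<phi> :: "complex^'n::finite \<Rightarrow> real"
  assumes "continuous_on UNIV \<phi>" and bound: "\<And>z. \<bar>\<phi> z\<bar> \<le> 1"
  shows "square_integrable (\<lambda>x. \<phi> (torus_map x) *\<^sub>R h)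
    \<and> to_L2 (\<lambda>x. \<phi> (torus_map x) *\<^sub>R h) \<in> closure trig_span"
proof -
  have "\<exists>p. trig_poly (\<lambda>x. complex_of_real (p x)) \<and> (\<forall>x. \<bar>\<phi> (torus_map x) - p x\<bar> < inverse (real (Suc n)))" for n
    by (rule trig_poly_uniformly_dense[OF assms(1), of "inverse (real (Suc n))"]) auto
  then obtain p where p: "trig_poly (\<lambda>x. complex_of_real (p n x))"
    "\<bar>\<phi> (torus_map x) - p n x\<bar> < inverse (real (Suc n))" for n x
    by metis
  have p_span: "square_integrable (\<lambda>x. p n x *\<^sub>R h)" "to_L2 (\<lambda>x. p n x *\<^sub>R h) \<in> trig_span" for n
    using trig_poly_in_trig_span[OF p(1), of n h] by (simp_all add: scaleC_of_real)
  have "(\<lambda>x. \<phi> (torus_map x)) \<in> borel_measurable torus_measure"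
    using borel_measurable_continuous_onI[OF assms(1)] borel_measurable_torus_map
    by (rule measurable_compose[rotated])
  then have sq: "square_integrable (\<lambda>x. \<phi> (torus_map x) *\<^sub>R h)"
    using mult_right_mono[OF bound norm_ge_zero[of h]]
    by (intro square_integrable_bounded[where B="norm h"]) auto
  interpret finite_measure "torus_measure :: (real^'n) measure"
    by (rule finite_measure_torus)
  have "(\<lambda>n. to_L2 (\<lambda>x. p n x *\<^sub>R h)) \<longlonglongrightarrow> to_L2 (\<lambda>x. \<phi> (torus_map x) *\<^sub>R h)"
  proof (rule to_L2_dominated_convergence[OF p_span(1) sq])
    \<comment> \<open>\<open>\<phi>\<close> is bounded by 1 and the error by
      \<open>inverse (real (Suc n))\<close>, hence by 1, so every \<open>p n\<close> is bounded by
      2.\<close>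
    show "integrable torus_measure (\<lambda>x::real^'n. (2 * norm h)\<^sup>2)"
      by (rule integrable_const)
    fix x :: "real^'n"
    have "(\<lambda>n. \<phi> (torus_map x) - p n x) \<longlonglongrightarrow> 0"
      using less_imp_le[OF p(2)[of x]] by (intro Lim_null_comparison[OF _ LIMSEQ_inverse_real_of_nat])
        (simp add: eventuallyI del: of_nat_Suc)
    from tendsto_diff[OF tendsto_const[of "\<phi> (torus_map x)"] this]
    show "(\<lambda>n. p n x *\<^sub>R h) \<longlonglongrightarrow> \<phi> (torus_map x) *\<^sub>R h"
      by (intro tendsto_intros) simp
    fix n
    have "inverse (real (Suc n)) \<le> 1"
      by (simp add: field_simps)
    then have "\<bar>p n x\<bar> \<le> 2"
      using p(2)[of x n] bound[of "torus_map x"] by linarith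
    then show "norm (p n x *\<^sub>R h) \<le> 2 * norm h"
      by (simp add: mult_right_mono)
  qed
  then show ?thesis
    unfolding closure_sequential using sq p_span(2)
    by (intro conjI exI[of _ "\<lambda>n. to_L2 (\<lambda>x. p n x *\<^sub>R h)"]) auto
qed

lemma square_integrable_indicator:
  fixes h :: "'h::{complex_hilbert, second_countable_topology}"
  assumes "A \<in> sets borel"
  shows "square_integrable (\<lambda>x::real^'n::finite. indicator A (torus_map x) *\<^sub>R h)"
proof (rule square_integrable_bounded[where B="norm h"])
  have "(\<lambda>x. indicator A (torus_map x) :: real) \<in> borel_measurable torus_measure"
    using borel_measurable_indicator[OF assms] borel_measurable_torus_map
    by (rule measurable_compose[rotated])
  then show "(\<lambda>x. indicator A (torus_map x) *\<^sub>R h) \<in> borel_measurable torus_measure"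
    by simp
qed (simp add: indicator_def)

text \<open>By the pi-lambda theorem the intersection-stable family of closed sets suffices: the
  closure of \<open>trig_span\<close> is a closed subspace that contains the constants, so the sets
  in question are stable under complements and countable disjoint unions.\<close>

lemma indicator_in_closure_trig_span:
  fixes h :: "'h::{complex_hilbert, second_countable_topology}"
    and A :: "(complex^'n::finite) set"
  assumes "A \<in> sets borel"
  shows "to_L2 (\<lambda>x::real^'n. indicator A (torus_map x) *\<^sub>R h) \<in> closure trig_span"
proof -
  interpret finite_measure "torus_measure :: (real^'n) measure"
    by (rule finite_measure_torus)
  note sq = square_integrable_indicator
  have "Int_stable (Collect closed :: (complex^'n) set set)"
    by (auto simp: Int_stable_def)
  moreover have "Collect closed \<subseteq> Pow (UNIV :: (complex^'n) set)"
    by simp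
  moreover have borel: "sigma_sets UNIV (Collect closed) = (sets borel :: (complex^'n) set set)"
    by (simp add: borel_eq_closed)
  then have "A \<in> sigma_sets UNIV (Collect closed)"
    using assms by simp
  ultimately show ?thesis
  proof (induction rule: sigma_sets_induct_disjoint)
    case (basic C)
    then have C: "closed C" "C \<in> sets borel"
      by auto
    show ?case
    proof (cases "C = {}")
      case False
      \<comment> \<open>Continuous functions that are 1 on \<open>C\<close> and, for positive
        \<open>n\<close>, 0 at distance at least \<open>1 / n\<close> from \<open>C\<close>; they
        tend to the indicator because \<open>C\<close> is closed. The empty set is treated apart
        since \<open>infdist z {}\<close> is 0.\<close>
      define \<phi> where "\<phi> n z = max 0 (1 - real n * infdist z C)" for n z
      have \<phi>: "continuous_on UNIV (\<phi> n)" "\<bar>\<phi> n z\<bar> \<le> 1" for n z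
        unfolding \<phi>_def by (auto intro!: continuous_intros simp: infdist_nonneg)
      note \<phi>_span = continuous_in_closure_trig_span[OF \<phi>, of _ h]
      have "(\<lambda>n. to_L2 (\<lambda>x. \<phi> n (torus_map x) *\<^sub>R h))
          \<longlonglongrightarrow> to_L2 (\<lambda>x::real^'n. indicator C (torus_map x) *\<^sub>R h)"
      proof (rule to_L2_dominated_convergence[OF conjunct1[OF \<phi>_span] sq[OF C(2)]])
        show "integrable torus_measure (\<lambda>x::real^'n. (norm h)\<^sup>2)"
          by (rule integrable_const)
        fix x :: "real^'n"
        have "(\<lambda>n. \<phi> n z) \<longlonglongrightarrow> indicator C z" for z
        proof (cases "z \<in> C")
          case True
          then show ?thesis
            by (simp add: \<phi>_def)
        next
          case nz: False
          then have "infdist z C > 0"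
            using C(1) False infdist_pos_not_in_closed by blast
          then have "\<forall>\<^sub>F n in sequentially. \<phi> n z = 0"
            using eventually_ge_at_top[of "nat \<lceil>1 / infdist z C\<rceil>"]
          proof (elim eventually_mono)
            fix n assume "nat \<lceil>1 / infdist z C\<rceil> \<le> n"
            then have "1 / infdist z C \<le> real n"
              by linarith
            then show "\<phi> n z = 0"
              using \<open>infdist z C > 0\<close> by (simp add: \<phi>_def field_simps)
          qed
          then show ?thesis
            using nz by (simp add: tendsto_eventually)
        qed
        then show "(\<lambda>n. \<phi> n (torus_map x) *\<^sub>R h) \<longlonglongrightarrow> indicator C (torus_map x) *\<^sub>R h"
          by (intro tendsto_intros)
        show "norm (\<phi> n (torus_map x) *\<^sub>R h) \<le> norm h" for n
          using mult_right_mono[OF \<phi>(2), of "norm h" n "torus_map x"] by simp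
      qed
      then show ?thesis
        using \<phi>_span by (intro Lim_in_closed_set[OF closed_closure]) auto
    qed (simp add: to_L2_zero complex_vector.subspace_0[OF csubspace_closure_trig_span])
  next
    case empty
    show ?case
      by (simp add: to_L2_zero complex_vector.subspace_0[OF csubspace_closure_trig_span])
  next
    case (compl B)
    then have B: "B \<in> sets borel"
      by (simp add: borel)
    have "to_L2 (\<lambda>x::real^'n. indicator UNIV (torus_map x) *\<^sub>R h) \<in> closure trig_span"
      using continuous_in_closure_trig_span[of "\<lambda>_::complex^'n. 1" h] by simp
    with compl have "to_L2 (\<lambda>x::real^'n. indicator UNIV (torus_map x) *\<^sub>R h - indicator B (torus_map x) *\<^sub>R h)
        \<in> closure trig_span"
      by (subst to_L2_diff[OF sq sq[OF B]])
        (auto intro: complex_vector.subspace_diff[OF csubspace_closure_trig_span])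
    moreover have "indicator UNIV (torus_map x) *\<^sub>R h - indicator B (torus_map x) *\<^sub>R h
        = indicator (UNIV - B) (torus_map x) *\<^sub>R h" for x :: "real^'n"
      by (simp add: indicator_def)
    ultimately show ?case
      by simp
  next
    case (union B)
    then have B: "B i \<in> sets borel" for i
      by (auto simp: borel)
    \<comment> \<open>Disjointness makes the indicator of a finite union a sum of indicators; the
      countable union is then a limit dominated by the constant \<open>norm h\<close>.\<close>
    have "to_L2 (\<lambda>x::real^'n. indicator (\<Union>i<k. B i) (torus_map x) *\<^sub>R h) \<in> closure trig_span" for k
    proof (induction k)
      case (Suc k)
      have "indicator (\<Union>i<Suc k. B i) z *\<^sub>R h = indicator (\<Union>i<k. B i) z *\<^sub>R h + indicator (B k) z *\<^sub>R h" for z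
      proof -
        have "B k \<inter> (\<Union>i<k. B i) = {}"
          using disjoint_family_onD[OF union(1), of _ k] by fastforce
        then show ?thesis
          by (auto simp: indicator_def lessThan_Suc)
      qed
      then have "to_L2 (\<lambda>x::real^'n. indicator (\<Union>i<Suc k. B i) (torus_map x) *\<^sub>R h)
          = to_L2 (\<lambda>x. indicator (\<Union>i<k. B i) (torus_map x) *\<^sub>R h) + to_L2 (\<lambda>x. indicator (B k) (torus_map x) *\<^sub>R h)"
        using B by (simp only:) (intro to_L2_add sq sets.finite_UN, auto)
      then show ?case
        using Suc union(3) by (auto intro: complex_vector.subspace_add[OF csubspace_closure_trig_span])
    qed (simp add: to_L2_zero complex_vector.subspace_0[OF csubspace_closure_trig_span])
    moreover have "(\<lambda>k. to_L2 (\<lambda>x::real^'n. indicator (\<Union>i<k. B i) (torus_map x) *\<^sub>R h))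
        \<longlonglongrightarrow> to_L2 (\<lambda>x. indicator (\<Union>i. B i) (torus_map x) *\<^sub>R h)"
    proof (rule to_L2_dominated_convergence)
      show "square_integrable (\<lambda>x::real^'n. indicator (\<Union>i<k. B i) (torus_map x) *\<^sub>R h)" for k
        using B by (intro sq sets.finite_UN) auto
      show "square_integrable (\<lambda>x::real^'n. indicator (\<Union>i. B i) (torus_map x) *\<^sub>R h)"
        using B by (intro sq sets.countable_UN) auto
      show "integrable torus_measure (\<lambda>x::real^'n. (norm h)\<^sup>2)"
        by (rule integrable_const)
      show "(\<lambda>k. indicator (\<Union>i<k. B i) (torus_map x) *\<^sub>R h) \<longlonglongrightarrow> indicator (\<Union>i. B i) (torus_map x) *\<^sub>R h" for x :: "real^'n"
        by (intro tendsto_scaleR LIMSEQ_indicator_UN tendsto_const)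
    qed (auto simp: indicator_def)
    ultimately show ?case
      by (intro Lim_in_closed_set[OF closed_closure]) auto
  qed
qed

text \<open>\<open>Arg2pi\<close> jumps across the positive real axis, but its sublevel sets are
  closed, and these decide measurability.\<close>

lemma borel_measurable_Arg2pi: "Arg2pi \<in> borel_measurable borel"
  by (simp add: borel_measurable_iff_le closed_Arg2pi2pi_le)

text \<open>On the cube \<open>torus_map\<close> has a Borel left inverse, given by normalised
  arguments, and \<open>B\<close> is the preimage under it of a Borel set that cuts out
  \<open>A\<close>. Functions of \<open>torus_map x\<close> therefore reach every measurable set of
  the cube.\<close>

lemma sets_torus_measureE:
  assumes "A \<in> sets (torus_measure :: (real^'n::finite) measure)"
  obtains B where "B \<in> sets borel" "\<And>x. x \<in> space torus_measure \<Longrightarrow> torus_map x \<in> B \<longleftrightarrow> x \<in> A"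
proof -
  obtain A' where A': "A' \<in> sets borel" "A = space torus_measure \<inter> A'"
    using assms unfolding torus_measure_def sets_restrict_space by (auto simp: space_restrict_space)
  define J :: "complex^'n \<Rightarrow> real^'n" where "J z = (\<chi> i. Arg2pi (z $ i) / (2 * pi))" for z
  have "J \<in> borel_measurable borel"
    unfolding borel_measurable_euclidean_space[of J]
  proof
    fix b :: "real^'n" assume "b \<in> Basis"
    then obtain i where b: "b = axis i 1"
      by (auto simp: Basis_vec_def)
    have "(\<lambda>z::complex^'n. z $ i) \<in> borel_measurable borel"
      by (intro borel_measurable_continuous_onI continuous_intros)
    then have "(\<lambda>z::complex^'n. Arg2pi (z $ i)) \<in> borel_measurable borel"
      using borel_measurable_Arg2pi by (rule measurable_compose)
    then show "(\<lambda>z. J z \<bullet> b) \<in> borel_measurable borel"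
      by (simp add: b J_def inner_axis)
  qed
  then have "J -` A' \<in> sets borel"
    using A'(1) by (auto dest: measurable_sets)
  moreover have "J (torus_map x) = x" if "x \<in> space torus_measure" for x
  proof -
    \<comment> \<open>The half-open cube matters here: \<open>Arg2pi\<close> takes values between 0
      and \<open>2 * pi\<close> with the right end excluded.\<close>
    have "Arg2pi (cis (2 * pi * x $ i)) = 2 * pi * x $ i" for i
      using that by (intro Arg2pi_unique[of 1]) (auto simp: space_torus_measure cis_conv_exp)
    then show ?thesis
      by (simp add: J_def torus_map_def vec_eq_iff)
  qed
  ultimately show ?thesis
    using A'(2) by (intro that[of "J -` A'"]) auto
qed

text \<open>A measurable function is a limit of simple functions. These are finite sums of
  indicators times vectors, and their level sets in the cube are preimages under
  \<open>torus_map\<close>.\<close>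

lemma closure_trig_span:
  "closure (trig_span :: ('n::finite, 'h::{complex_hilbert, second_countable_topology}) torus_L2 set) = UNIV"
proof -
  have "F \<in> closure trig_span" for F :: "('n, 'h) torus_L2"
  proof -
    obtain f where f: "square_integrable f" "F = to_L2 f"
      by (rule to_L2_surj)
    then have "f \<in> borel_measurable torus_measure"
      by (simp add: square_integrable_def)
    \<comment> \<open>With base point 0 the bound on distances becomes a bound on norms, which
      supplies the square integrable majorant \<open>2 * norm (f x)\<close>.\<close>
    from borel_measurable_implies_sequence_metric[OF this, of 0]
    obtain s where s: "\<And>i. simple_function torus_measure (s i)"
      "\<And>x. x \<in> space torus_measure \<Longrightarrow> (\<lambda>i. s i x) \<longlonglongrightarrow> f x"
      "\<And>i x. x \<in> space torus_measure \<Longrightarrow> norm (s i x) \<le> 2 * norm (f x)"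
      by (simp only: dist_0_norm dist_commute[of _ 0]) blast
    have s_span: "square_integrable (s i) \<and> to_L2 (s i) \<in> closure trig_span" for i
    proof -
      let ?Y = "s i ` space torus_measure"
      have fin: "finite ?Y"
        using s(1) by (rule simple_functionD)
      have "\<exists>B. B \<in> sets borel \<and> (\<forall>x\<in>space torus_measure. torus_map x \<in> B \<longleftrightarrow> s i x = y)" for y
      proof -
        have "s i -` {y} \<inter> space torus_measure \<in> sets torus_measure"
          using s(1) by (rule simple_functionD)
        from sets_torus_measureE[OF this] show ?thesis
          by (metis IntD1 IntI vimage_singleton_eq)
      qed
      then obtain B where B: "\<And>y. B y \<in> sets borel"
        "\<And>x y. x \<in> space torus_measure \<Longrightarrow> torus_map x \<in> B y \<longleftrightarrow> s i x = y"
        by metis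
      have sum: "square_integrable (\<lambda>x. \<Sum>y\<in>Y. indicator (B y) (torus_map x) *\<^sub>R y)
          \<and> to_L2 (\<lambda>x. \<Sum>y\<in>Y. indicator (B y) (torus_map x) *\<^sub>R y) \<in> closure trig_span"
        if "finite Y" for Y
        using that
      proof induction
        case (insert y Y)
        let ?s = "\<lambda>x. \<Sum>y\<in>Y. indicator (B y) (torus_map x) *\<^sub>R y"
        note sq = square_integrable_indicator[OF B(1)[of y], of y]
        have Y: "square_integrable ?s" "to_L2 ?s \<in> closure trig_span"
          using insert by blast+
        have "to_L2 (\<lambda>x. indicator (B y) (torus_map x) *\<^sub>R y) + to_L2 ?s \<in> closure trig_span"
          by (rule complex_vector.subspace_add[OF csubspace_closure_trig_span
                indicator_in_closure_trig_span[OF B(1)] Y(2)])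
        then show ?case
          unfolding sum.insert[OF insert(1,2)] to_L2_add[OF sq Y(1)]
          using square_integrable_add[OF sq Y(1)] by blast
      qed (simp add: square_integrable_zero to_L2_zero complex_vector.subspace_0[OF csubspace_closure_trig_span])
      \<comment> \<open>The two sides may differ outside the cube, where membership in
        \<open>B y\<close> is not controlled; equality of classes asks only for points of
        \<open>space torus_measure\<close>.\<close>
      have eq: "s i x = (\<Sum>y\<in>?Y. indicator (B y) (torus_map x) *\<^sub>R y)" if "x \<in> space torus_measure" for x
      proof -
        have "(\<Sum>y\<in>?Y. indicator (B y) (torus_map x) *\<^sub>R y) = (\<Sum>y\<in>?Y. if s i x = y then y else 0)"
          using that by (intro sum.cong) (auto simp: B(2))
        then show ?thesis
          using that fin by simp
      qed
      have sq: "square_integrable (s i)"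
        unfolding square_integrable_def
      proof
        show m: "s i \<in> borel_measurable torus_measure"
          using s(1) by (rule borel_measurable_simple_function)
        show "integrable torus_measure (\<lambda>x. (norm (s i x))\<^sup>2)"
        proof (rule Bochner_Integration.integrable_bound)
          show "integrable torus_measure (\<lambda>x. 4 * (norm (f x))\<^sup>2)"
            using f(1) by (simp add: square_integrable_def)
          show "(\<lambda>x. (norm (s i x))\<^sup>2) \<in> borel_measurable torus_measure"
            using m by simp
          show "AE x in torus_measure. norm ((norm (s i x))\<^sup>2) \<le> norm (4 * (norm (f x))\<^sup>2)"
          proof (rule AE_I2)
            fix x :: "real^'n" assume "x \<in> space torus_measure"
            then have "(norm (s i x))\<^sup>2 \<le> (2 * norm (f x))\<^sup>2"
              by (intro power_mono s(3)) auto
            then show "norm ((norm (s i x))\<^sup>2) \<le> norm (4 * (norm (f x))\<^sup>2)"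
              by (simp add: power_mult_distrib)
          qed
        qed
      qed
      have "to_L2 (s i) = to_L2 (\<lambda>x. \<Sum>y\<in>?Y. indicator (B y) (torus_map x) *\<^sub>R y)"
        by (rule to_L2_eqI[OF sq conjunct1[OF sum[OF fin]] eq])
      then show ?thesis
        using sum[OF fin] sq by simp
    qed
    have "(\<lambda>i. to_L2 (s i)) \<longlonglongrightarrow> to_L2 f"
    proof (rule to_L2_dominated_convergence)
      show "integrable torus_measure (\<lambda>x. (2 * norm (f x))\<^sup>2)"
        using f(1) by (simp add: square_integrable_def power_mult_distrib)
    qed (use s s_span f in auto)
    then show ?thesis
      unfolding f(2) using s_span by (intro Lim_in_closed_set[OF closed_closure]) auto
  qed
  then show ?thesis
    by blast
qed

section \<open>Fourier series\<close>

lemma additive_fourier: "Modules.additive (\<lambda>f. fourier f \<xi>)"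
  by standard (rule fourier_add)

lemma additive_fourier_mode: "Modules.additive (fourier_mode \<xi>)"
  by standard (rule fourier_mode_add)

lemmas fourier_zero = additive.zero[OF additive_fourier]
  and fourier_diff = additive.diff[OF additive_fourier]
  and fourier_sum = additive.sum[OF additive_fourier]
  and fourier_mode_zero = additive.zero[OF additive_fourier_mode]
  and fourier_mode_diff = additive.diff[OF additive_fourier_mode]

lemma cinner_sum_right: "cinner (z::'a::complex_inner) (\<Sum>i\<in>I. f i) = (\<Sum>i\<in>I. cinner z (f i))"
  by (rule bounded_bilinear.sum_right[OF bounded_bilinear_cinner])

text \<open>For finite \<open>S\<close> this is the orthogonal projection of \<open>f\<close> onto
  the functions with all frequencies in \<open>S\<close>.\<close>

definition partial_sum ::
  "(int^'n) set \<Rightarrow> ('n::finite, 'h::{complex_hilbert, second_countable_topology}) torus_L2 \<Rightarrow> ('n, 'h) torus_L2"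
  where "partial_sum S f = (\<Sum>\<xi>\<in>S. fourier_mode \<xi> (fourier f \<xi>))"

lemma fourier_partial_sum:
  assumes "finite S"
  shows "fourier (partial_sum S f) \<eta> = (if \<eta> \<in> S then fourier f \<eta> else 0)"
  using assms by (simp add: partial_sum_def fourier_sum fourier_fourier_mode sum.delta)

lemma cinner_partial_sum: "cinner g (partial_sum S f) = (\<Sum>\<xi>\<in>S. cinner (fourier g \<xi>) (fourier f \<xi>))"
  by (simp add: partial_sum_def cinner_sum_right cinner_fourier_mode)

lemma partial_sum_add: "partial_sum S (f + g) = partial_sum S f + partial_sum S g"
  by (simp add: partial_sum_def fourier_add fourier_mode_add sum.distrib)

lemma partial_sum_diff: "partial_sum S (f - g) = partial_sum S f - partial_sum S g"
  by (simp add: partial_sum_def fourier_diff fourier_mode_diff sum_subtractf)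

lemma partial_sum_scaleC: "partial_sum S (c *\<^sub>C f) = c *\<^sub>C partial_sum S f"
  by (simp add: partial_sum_def fourier_scaleC fourier_mode_scaleC complex_vector.scale_sum_right)

text \<open>\<open>f - partial_sum S f\<close> has no coefficients in \<open>S\<close>, and
  \<open>partial_sum S g\<close> has none outside. With \<open>g = f\<close> this gives Bessel's
  inequality; with \<open>g = f - p\<close>, for \<open>p\<close> fixed by the projection, it says
  that the projection is the best approximation.\<close>

lemma norm_pythagoras_partial_sum:
  assumes "finite S"
  shows "(norm (f - partial_sum S f + partial_sum S g))\<^sup>2
    = (norm (f - partial_sum S f))\<^sup>2 + (norm (partial_sum S g))\<^sup>2"
  using assms by (simp add: norm_add_square cinner_partial_sum fourier_diff fourier_partial_sum)

lemma bessel_inequality: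
  assumes "finite S"
  shows "(\<Sum>\<xi>\<in>S. (norm (fourier f \<xi>))\<^sup>2) \<le> (norm f)\<^sup>2"
proof -
  have "complex_of_real ((norm (partial_sum S f))\<^sup>2) = complex_of_real (\<Sum>\<xi>\<in>S. (norm (fourier f \<xi>))\<^sup>2)"
    unfolding cinner_self[symmetric] of_real_sum
    using assms by (simp add: cinner_partial_sum fourier_partial_sum)
  then have "(norm (partial_sum S f))\<^sup>2 = (\<Sum>\<xi>\<in>S. (norm (fourier f \<xi>))\<^sup>2)"
    by (simp only: of_real_eq_iff)
  with norm_pythagoras_partial_sum[OF assms, of f f] show ?thesis
    by simp
qed

lemma partial_sum_trig_span:
  fixes p :: "('n::finite, 'h::{complex_hilbert, second_countable_topology}) torus_L2"
  assumes "p \<in> trig_span"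
  obtains S where "finite S" "partial_sum S p = p"
proof -
  \<comment> \<open>Stability under enlarging \<open>S\<close> is built into the induction, so that
    two functions can share the union of their frequency sets.\<close>
  let ?P = "\<lambda>p. \<exists>S. finite S \<and> (\<forall>S'. finite S' \<longrightarrow> S \<subseteq> S' \<longrightarrow> partial_sum S' p = p)"
  have "?P p"
    using assms unfolding trig_span_def
  proof (induction rule: complex_vector.span_induct)
    show "csubspace {p :: ('n, 'h) torus_L2. ?P p}"
    proof (rule complex_vector.subspaceI)
      show "0 \<in> {p :: ('n, 'h) torus_L2. ?P p}"
        by (auto simp: partial_sum_def fourier_zero fourier_mode_zero)
    next
      fix f g :: "('n, 'h) torus_L2"
      assume "f \<in> {p. ?P p}" "g \<in> {p. ?P p}"
      then obtain S T where "finite S" "\<forall>S'. finite S' \<longrightarrow> S \<subseteq> S' \<longrightarrow> partial_sum S' f = f"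
        "finite T" "\<forall>S'. finite S' \<longrightarrow> T \<subseteq> S' \<longrightarrow> partial_sum S' g = g"
        by blast
      then show "f + g \<in> {p. ?P p}"
        by (auto simp: partial_sum_add intro!: exI[of _ "S \<union> T"])
    next
      fix c and f :: "('n, 'h) torus_L2"
      assume "f \<in> {p. ?P p}"
      then show "c *\<^sub>C f \<in> {p. ?P p}"
        by (auto simp: partial_sum_scaleC)
    qed
  next
    fix p :: "('n, 'h) torus_L2"
    assume "p \<in> (\<Union>\<xi>. range (fourier_mode \<xi>))"
    then obtain \<xi> h where p: "p = fourier_mode \<xi> h"
      by blast
    have "partial_sum S' p = p" if "finite S'" "{\<xi>} \<subseteq> S'" for S'
    proof -
      have "partial_sum S' p = (\<Sum>\<eta>\<in>S'. if \<eta> = \<xi> then p else 0)"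
        unfolding partial_sum_def p
        by (intro sum.cong) (auto simp: fourier_fourier_mode fourier_mode_zero)
      then show ?thesis
        using that by simp
    qed
    then show "?P p"
      by (intro exI[of _ "{\<xi>}"]) auto
  qed
  then show ?thesis
    using that by blast
qed

lemma partial_sums_dense:
  fixes f :: "('n::finite, 'h::{complex_hilbert, second_countable_topology}) torus_L2"
  assumes "\<epsilon> > 0"
  obtains S where "finite S" "norm (f - partial_sum S f) < \<epsilon>"
proof -
  have "f \<in> closure trig_span"
    by (simp add: closure_trig_span)
  then obtain p where p: "p \<in> trig_span" "dist p f < \<epsilon>"
    using assms unfolding closure_approachable by blast
  from p(1) obtain S where S: "finite S" "partial_sum S p = p"
    by (rule partial_sum_trig_span)
  \<comment> \<open>Since \<open>p\<close> is its own projection, \<open>f - p\<close> splits into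
    orthogonal parts, one of which is \<open>f - partial_sum S f\<close>.\<close>
  have eq: "f - partial_sum S f + partial_sum S (f - p) = f - p"
    by (simp add: partial_sum_diff S(2))
  have "(norm (f - partial_sum S f))\<^sup>2 \<le> (norm (f - p))\<^sup>2"
    using norm_pythagoras_partial_sum[OF S(1), of f "f - p"] unfolding eq
    by (metis le_add_same_cancel1 zero_le_power2)
  then have "norm (f - partial_sum S f) \<le> norm (f - p)"
    by (rule power2_le_imp_le) simp
  then show ?thesis
    using p(2) S(1) by (intro that[of S]) (auto simp: dist_norm norm_minus_commute)
qed

text \<open>Partial sums of \<open>g\<close> are orthogonal to \<open>f\<close> and approximate
  \<open>g\<close>. All later uses of completeness go through this lemma.\<close>

lemma cinner_eq_0_if_fourier:
  fixes f g :: "('n::finite, 'h::{complex_hilbert, second_countable_topology}) torus_L2"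
  assumes "\<And>\<xi>. cinner (fourier f \<xi>) (fourier g \<xi>) = 0"
  shows "cinner f g = 0"
proof (rule ccontr)
  assume "cinner f g \<noteq> 0"
  then have pos: "cmod (cinner f g) > 0"
    by simp
  \<comment> \<open>The factor 2 compensates the constant in \<open>norm_cinner_le\<close>; adding 1
    keeps the denominator positive and makes the final estimate strict.\<close>
  define \<epsilon> where "\<epsilon> = cmod (cinner f g) / (2 * (norm f + 1))"
  have "\<epsilon> > 0"
    unfolding \<epsilon>_def using pos by (intro divide_pos_pos) (auto intro: add_nonneg_pos)
  then obtain S where S: "finite S" "norm (g - partial_sum S g) < \<epsilon>"
    by (rule partial_sums_dense)
  have "cinner f (partial_sum S g) = 0"
    by (simp add: cinner_partial_sum assms)
  then have "cinner f g = cinner f (g - partial_sum S g)"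
    by (simp add: bounded_bilinear.diff_right[OF bounded_bilinear_cinner])
  then have "cmod (cinner f g) \<le> 2 * (norm f * norm (g - partial_sum S g))"
    using norm_cinner_le[of f "g - partial_sum S g"] by simp
  also have "\<dots> \<le> 2 * (norm f * \<epsilon>)"
    using S(2) by (intro mult_left_mono) auto
  also have "\<dots> < 2 * ((norm f + 1) * \<epsilon>)"
    using \<open>\<epsilon> > 0\<close> by (simp add: distrib_right)
  also have "\<dots> = cmod (cinner f g)"
    using norm_ge_zero[of f] by (simp add: \<epsilon>_def field_simps add_nonneg_eq_0_iff)
  finally show False
    by simp
qed

lemma fourier_inject:
  assumes "\<And>\<xi>. fourier f \<xi> = fourier g \<xi>"
  shows "f = g"
proof -
  have "cinner (f - g) (f - g) = 0"
    by (rule cinner_eq_0_if_fourier) (simp add: fourier_diff assms)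
  then show ?thesis
    by (simp add: cinner_self)
qed

section \<open>Subspaces cut out by conditions on the Fourier coefficients\<close>

lemma bounded_linear_fourier_mode: "bounded_linear (fourier_mode \<xi>)"
  using additive.add[OF additive_fourier_mode]
  by (intro bounded_linear_intro[where K=1])
    (auto simp: norm_fourier_mode fourier_mode_scaleC scaleC_of_real[symmetric])

lemma fourier_mode_span: "v \<in> cspan B \<Longrightarrow> fourier_mode \<xi> v \<in> cspan (fourier_mode \<xi> ` B)"
proof (induction rule: complex_vector.span_induct)
  show "csubspace {v. fourier_mode \<xi> v \<in> cspan (fourier_mode \<xi> ` B)}"
    by (auto simp: complex_vector.subspace_def fourier_mode_zero fourier_mode_add fourier_mode_scaleC
        intro: complex_vector.span_zero complex_vector.span_add complex_vector.span_scale)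
qed (auto intro: complex_vector.span_base)

lemma fourier_span: "f \<in> cspan F \<Longrightarrow> fourier f \<xi> \<in> cspan ((\<lambda>f. fourier f \<xi>) ` F)"
proof (induction rule: complex_vector.span_induct)
  show "csubspace {f. fourier f \<xi> \<in> cspan ((\<lambda>f. fourier f \<xi>) ` F)}"
    by (auto simp: complex_vector.subspace_def fourier_zero fourier_add fourier_scaleC
        intro: complex_vector.span_zero complex_vector.span_add complex_vector.span_scale)
qed (auto intro: complex_vector.span_base)

lemma inj_fourier_mode: "inj (fourier_mode \<xi>)"
  by (rule injI) (metis fourier_fourier_mode)

text \<open>The coefficient map at one frequency \<open>\<eta>\<close> annihilates the modes of all
  other frequencies, so it turns a vanishing combination into one of elements of
  \<open>B \<eta>\<close>.\<close>

lemma independent_fourier_modes: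
  assumes indep: "\<And>\<xi>. \<not> complex_vector.dependent (B \<xi>)"
  shows "\<not> complex_vector.dependent (\<Union>\<xi>. fourier_mode \<xi> ` B \<xi>)"
  unfolding complex_vector.independent_explicit_finite_subsets
proof (intro allI impI ballI)
  fix S u v
  assume S: "S \<subseteq> (\<Union>\<xi>. fourier_mode \<xi> ` B \<xi>)" "finite S"
    and sum: "(\<Sum>v\<in>S. u v *\<^sub>C v) = 0" and "v \<in> S"
  then obtain \<eta> b where v: "b \<in> B \<eta>" "v = fourier_mode \<eta> b"
    by blast
  define T where "T = {b \<in> B \<eta>. fourier_mode \<eta> b \<in> S}"
  have img: "fourier_mode \<eta> ` T \<subseteq> S"
    by (auto simp: T_def)
  have inj: "inj_on (fourier_mode \<eta>) T"
    using inj_fourier_mode by (rule inj_on_subset) simp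
  have T: "finite T" "T \<subseteq> B \<eta>" "b \<in> T"
    by (rule finite_imageD[OF finite_subset[OF img S(2)] inj])
      (use v \<open>v \<in> S\<close> in \<open>auto simp: T_def\<close>)
  have "fourier w \<eta> = 0" if w: "w \<in> S - fourier_mode \<eta> ` T" for w
  proof -
    obtain \<xi> b where b: "b \<in> B \<xi>" "w = fourier_mode \<xi> b"
      using w S(1) by blast
    then have "\<xi> \<noteq> \<eta>"
      using w by (auto simp: T_def)
    then show ?thesis
      by (simp add: b fourier_fourier_mode)
  qed
  then have "(\<Sum>w\<in>S. u w *\<^sub>C fourier w \<eta>) = (\<Sum>w\<in>fourier_mode \<eta> ` T. u w *\<^sub>C fourier w \<eta>)"
    using S(2) img by (intro sum.mono_neutral_right) auto
  also have "\<dots> = (\<Sum>b\<in>T. u (fourier_mode \<eta> b) *\<^sub>C b)"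
    by (simp add: sum.reindex[OF inj] fourier_fourier_mode)
  also have "(\<Sum>w\<in>S. u w *\<^sub>C fourier w \<eta>) = fourier (\<Sum>w\<in>S. u w *\<^sub>C w) \<eta>"
    by (simp add: fourier_sum fourier_scaleC)
  finally have "(\<Sum>b\<in>T. u (fourier_mode \<eta> b) *\<^sub>C b) = 0"
    by (simp add: sum fourier_zero)
  moreover have "\<forall>u. (\<Sum>b\<in>T. u b *\<^sub>C b) = 0 \<longrightarrow> (\<forall>b\<in>T. u b = 0)"
    using indep[of \<eta>] T(1,2) unfolding complex_vector.independent_explicit_finite_subsets by simp
  ultimately show "u v = 0"
    using T(3) unfolding v(2) by (auto dest: spec[of _ "\<lambda>b. u (fourier_mode \<eta> b)"])
qed

text \<open>The modes of bases of the \<open>V \<xi>\<close> form an independent set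
  \<open>BB\<close> inside the subspace in question. Finite dimension makes \<open>BB\<close>
  finite, hence also the set \<open>S\<close> of frequencies with nonzero \<open>V \<xi>\<close>;
  every member is then a finite Fourier sum, so \<open>BB\<close> is a basis. The explicit
  \<open>S\<close> lets the results for two families be combined later.\<close>

lemma cdim_fourier_subspace:
  fixes V :: "int^'n::finite \<Rightarrow> 'h::{complex_hilbert, second_countable_topology} set"
  assumes V: "\<And>\<xi>. csubspace (V \<xi>)" and fin: "cfinite_dim {f. \<forall>\<xi>. fourier f \<xi> \<in> V \<xi>}"
  obtains S where "finite S" "\<And>\<xi>. \<xi> \<notin> S \<Longrightarrow> cdim (V \<xi>) = 0"
    "cdim {f. \<forall>\<xi>. fourier f \<xi> \<in> V \<xi>} = (\<Sum>\<xi>\<in>S. cdim (V \<xi>))"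
proof -
  let ?W = "{f. \<forall>\<xi>. fourier f \<xi> \<in> V \<xi>}"
  have "\<exists>B. B \<subseteq> V \<xi> \<and> \<not> complex_vector.dependent B \<and> V \<xi> \<subseteq> cspan B \<and> card B = cdim (V \<xi>)" for \<xi>
    by (rule complex_vector.basis_exists[of "V \<xi>"]) (rule exI, intro conjI)
  then obtain B where B: "\<And>\<xi>. B \<xi> \<subseteq> V \<xi>" "\<And>\<xi>. \<not> complex_vector.dependent (B \<xi>)"
    "\<And>\<xi>. V \<xi> \<subseteq> cspan (B \<xi>)" "\<And>\<xi>. card (B \<xi>) = cdim (V \<xi>)"
    by metis
  define BB where "BB = (\<Union>\<xi>. fourier_mode \<xi> ` B \<xi>)"
  have indep: "\<not> complex_vector.dependent BB"
    unfolding BB_def using B(2) by (rule independent_fourier_modes)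
  have BB_W: "BB \<subseteq> ?W"
    by (auto simp: BB_def fourier_fourier_mode
        intro: subsetD[OF B(1)] complex_vector.subspace_0[OF V])
  obtain F where "finite F" "?W \<subseteq> cspan F"
    using fin unfolding cfinite_dim_def by blast
  then have fin_BB: "finite BB"
    using complex_vector.independent_span_bound[OF _ indep] BB_W by (meson subset_trans)
  define S where "S = {\<xi>. B \<xi> \<noteq> {}}"
  have B0: "0 \<notin> B \<xi>" for \<xi>
    using B(2)[of \<xi>] complex_vector.dependent_zero[of "B \<xi>"] by (rule contrapos_nn)
  obtain b where b: "\<And>\<xi>. \<xi> \<in> S \<Longrightarrow> b \<xi> \<in> B \<xi>"
  proof -
    have "\<forall>\<xi>\<in>S. \<exists>b. b \<in> B \<xi>"
      by (auto simp: S_def)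
    then show ?thesis
      using that by metis
  qed
  \<comment> \<open>One basis vector per frequency embeds \<open>S\<close> into \<open>BB\<close>,
    because a nonzero mode determines its frequency.\<close>
  have "inj_on (\<lambda>\<xi>. fourier_mode \<xi> (b \<xi>)) S"
  proof (rule inj_onI)
    fix \<xi> \<eta> assume "\<xi> \<in> S" and eq: "fourier_mode \<xi> (b \<xi>) = fourier_mode \<eta> (b \<eta>)"
    then have "b \<xi> \<noteq> 0"
      using b[of \<xi>] B0[of \<xi>] by auto
    moreover have "b \<xi> = fourier (fourier_mode \<eta> (b \<eta>)) \<xi>"
      by (simp add: eq[symmetric] fourier_fourier_mode)
    ultimately show "\<xi> = \<eta>"
      by (auto simp: fourier_fourier_mode split: if_splits)
  qed
  moreover have "(\<lambda>\<xi>. fourier_mode \<xi> (b \<xi>)) ` S \<subseteq> BB"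
    using b by (auto simp: BB_def)
  ultimately have S: "finite S"
    using fin_BB by (metis finite_imageD finite_subset)
  have W_BB: "?W \<subseteq> cspan BB"
  proof
    fix f assume f: "f \<in> ?W"
    then have coeff: "fourier f \<xi> \<in> cspan (B \<xi>)" for \<xi>
      using B(3)[of \<xi>] by blast
    have "fourier f \<xi> = 0" if "\<xi> \<notin> S" for \<xi>
      using coeff[of \<xi>] that by (simp add: S_def)
    then have "f = partial_sum S f"
      by (intro fourier_inject) (simp add: fourier_partial_sum S)
    moreover have "fourier_mode \<xi> (fourier f \<xi>) \<in> cspan BB" for \<xi>
    proof -
      have "fourier_mode \<xi> ` B \<xi> \<subseteq> BB"
        by (auto simp: BB_def)
      from complex_vector.span_mono[OF this] show ?thesis
        using fourier_mode_span[OF coeff] by blast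
    qed
    then have "partial_sum S f \<in> cspan BB"
      unfolding partial_sum_def by (rule complex_vector.span_sum)
    ultimately show "f \<in> cspan BB"
      by simp
  qed
  have fin_B: "finite (B \<xi>)" for \<xi>
  proof -
    have "fourier_mode \<xi> ` B \<xi> \<subseteq> BB"
      by (auto simp: BB_def)
    then have "finite (fourier_mode \<xi> ` B \<xi>)"
      using fin_BB by (rule finite_subset)
    then show ?thesis
      using inj_on_subset[OF inj_fourier_mode subset_UNIV] by (rule finite_imageD)
  qed
  have "BB = (\<Union>\<xi>\<in>S. fourier_mode \<xi> ` B \<xi>)"
    by (auto simp: BB_def S_def)
  moreover have "card (\<Union>\<xi>\<in>S. fourier_mode \<xi> ` B \<xi>) = (\<Sum>\<xi>\<in>S. card (fourier_mode \<xi> ` B \<xi>))"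
  proof (rule card_UN_disjoint[OF S])
    show "\<forall>\<xi>\<in>S. \<forall>\<eta>\<in>S. \<xi> \<noteq> \<eta> \<longrightarrow> fourier_mode \<xi> ` B \<xi> \<inter> fourier_mode \<eta> ` B \<eta> = {}"
    proof (intro ballI impI)
      fix \<xi> \<eta> :: "int^'n" assume "\<xi> \<noteq> \<eta>"
      then have "fourier_mode \<xi> v \<noteq> fourier_mode \<eta> w" if "v \<in> B \<xi>" for v w
        using B0[of \<xi>] that by (metis fourier_fourier_mode)
      then show "fourier_mode \<xi> ` B \<xi> \<inter> fourier_mode \<eta> ` B \<eta> = {}"
        by blast
    qed
  qed (simp add: fin_B)
  moreover have "card (fourier_mode \<xi> ` B \<xi>) = cdim (V \<xi>)" for \<xi>
    using card_image[OF inj_on_subset[OF inj_fourier_mode subset_UNIV], of \<xi> "B \<xi>"] B(4) by simp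
  moreover have "cdim ?W = card BB"
    using complex_vector.basis_card_eq_dim[OF BB_W W_BB indep] by simp
  ultimately have "cdim ?W = (\<Sum>\<xi>\<in>S. cdim (V \<xi>))"
    by simp
  moreover have "cdim (V \<xi>) = 0" if "\<xi> \<notin> S" for \<xi>
    using that B(4)[of \<xi>] by (auto simp: S_def)
  ultimately show ?thesis
    using S by (intro that)
qed

section \<open>Kernels of operators and of their adjoints\<close>

context
  fixes S :: "'a::complex_inner \<rightharpoonup> 'a"
  assumes S: "closed_densely_defined S"
begin

lemma csubspace_dom: "csubspace (dom S)"
  and closure_dom: "closure (dom S) = UNIV"
  using S by (simp_all add: closed_densely_defined_def)

lemma op_add:
  assumes "S x = Some u" "S y = Some v"
  shows "S (x + y) = Some (u + v)"
proof -
  have xy: "x \<in> dom S" "y \<in> dom S"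
    using assms by blast+
  then have "the (S (x + y)) = the (S x) + the (S y)"
    using S unfolding closed_densely_defined_def by blast
  moreover have "x + y \<in> dom S"
    by (rule complex_vector.subspace_add[OF csubspace_dom xy])
  ultimately show ?thesis
    using assms by auto
qed

lemma op_scaleC:
  assumes "S x = Some u"
  shows "S (c *\<^sub>C x) = Some (c *\<^sub>C u)"
proof -
  have x: "x \<in> dom S"
    using assms by blast
  then have "the (S (c *\<^sub>C x)) = c *\<^sub>C the (S x)"
    using S unfolding closed_densely_defined_def by blast
  moreover have "c *\<^sub>C x \<in> dom S"
    by (rule complex_vector.subspace_scale[OF csubspace_dom x])
  ultimately show ?thesis
    using assms by auto
qed

lemma op_zero: "S 0 = Some 0"
proof -
  obtain u where "S 0 = Some u"
    using complex_vector.subspace_0[OF csubspace_dom] by blast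
  from op_scaleC[OF this, of 0] show ?thesis
    by simp
qed

lemma op_diff: "S x = Some u \<Longrightarrow> S y = Some v \<Longrightarrow> S (x - y) = Some (u - v)"
  using op_add[of x u "(-1) *\<^sub>C y" "(-1) *\<^sub>C v"] op_scaleC[of y v "-1"] by simp

lemma csubspace_op_ker: "csubspace (op_ker S)"
  using op_zero op_add[of _ 0 _ 0] op_scaleC[of _ 0]
  by (simp add: complex_vector.subspace_def op_ker_def)

lemma csubspace_ran: "csubspace (ran S)"
proof (rule complex_vector.subspaceI)
  show "0 \<in> ran S"
    using op_zero by (rule ranI)
next
  fix u v assume "u \<in> ran S" "v \<in> ran S"
  then obtain x y where "S x = Some u" "S y = Some v"
    by (auto simp: ran_def)
  then show "u + v \<in> ran S"
    by (blast intro: ranI op_add)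
next
  fix c u assume "u \<in> ran S"
  then obtain x where "S x = Some u"
    by (auto simp: ran_def)
  then show "c *\<^sub>C u \<in> ran S"
    by (blast intro: ranI op_scaleC)
qed

text \<open>Density of the domain makes the definite description in \<^const>\<open>adjoint_op\<close> meaningful.\<close>

lemma op_ker_adjoint: "op_ker (adjoint_op S) = {y. \<forall>z\<in>ran S. cinner z y = 0}"
proof -
  have uniq: "z = z'" if "\<forall>x\<in>dom S. cinner x z = cinner x z'" for z z'
  proof -
    have "dom S \<subseteq> {x. cinner x (z - z') = 0}"
      using that by (auto simp: bounded_bilinear.diff_right[OF bounded_bilinear_cinner])
    moreover have "closed {x. cinner x (z - z') = 0}"
      by (intro closed_Collect_eq continuous_on_const
          linear_continuous_on[OF bounded_linear_cinner_left])
    ultimately have "z - z' \<in> {x. cinner x (z - z') = 0}"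
      using closure_minimal closure_dom by blast
    then show ?thesis
      by (simp add: cinner_self)
  qed
  have the_eq: "(THE z. \<forall>x\<in>dom S. cinner (the (S x)) y = cinner x z) = z"
    if "\<forall>x\<in>dom S. cinner (the (S x)) y = cinner x z" for y z
    using that by (rule the_equality) (rule uniq, use that in simp)
  have "adjoint_op S y = Some 0 \<longleftrightarrow> (\<forall>x\<in>dom S. cinner (the (S x)) y = 0)" for y
  proof
    assume *: "adjoint_op S y = Some 0"
    then obtain z where z: "\<forall>x\<in>dom S. cinner (the (S x)) y = cinner x z"
      unfolding adjoint_op_def by (metis option.distinct(1))
    then have "adjoint_op S y = Some z"
      unfolding adjoint_op_def the_eq[OF z] by (meson if_P)
    with * z show "\<forall>x\<in>dom S. cinner (the (S x)) y = 0"
      by simp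
  next
    assume "\<forall>x\<in>dom S. cinner (the (S x)) y = 0"
    then have z: "\<forall>x\<in>dom S. cinner (the (S x)) y = cinner x 0"
      by simp
    then show "adjoint_op S y = Some 0"
      unfolding adjoint_op_def the_eq[OF z] by (meson if_P)
  qed
  moreover have "ran S = (\<lambda>x. the (S x)) ` dom S"
    by (force simp: ran_def image_iff)
  ultimately show ?thesis
    by (simp add: op_ker_def)
qed

lemma csubspace_op_ker_adjoint: "csubspace (op_ker (adjoint_op S))"
  unfolding op_ker_adjoint
  by (auto simp: complex_vector.subspace_def cinner_add_right cinner_scaleC_right)

end

text \<open>Only 0 lies both in \<open>R\<close> and in its orthogonal complement, so the complement
  embeds into the quotient by \<open>R\<close>, which \<open>F\<close> spans. This turns the
  cokernel condition of \<open>fredholm\<close> into finite dimension of the kernel of the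
  adjoint.\<close>

lemma cfinite_dim_orthogonal:
  fixes R :: "'a::complex_inner set"
  assumes R: "csubspace R" and F: "finite F" "\<And>y. \<exists>z\<in>R. y - z \<in> cspan F"
  shows "cfinite_dim {y. \<forall>z\<in>R. cinner z y = 0}"
proof -
  let ?N = "{y. \<forall>z\<in>R. cinner z y = 0}"
  have N: "csubspace ?N"
    by (auto simp: complex_vector.subspace_def cinner_add_right cinner_scaleC_right)
  \<comment> \<open>The image of \<open>?N\<close> in the quotient by \<open>R\<close> is handled
    through its representatives in \<open>cspan F\<close>, collected in \<open>W\<close>. Below,
    \<open>Y\<close> lifts a basis of \<open>W\<close> back to \<open>?N\<close>.\<close>
  define W where "W = {s \<in> cspan F. \<exists>y\<in>?N. y - s \<in> R}"
  obtain B where B: "B \<subseteq> W" "\<not> complex_vector.dependent B" "W \<subseteq> cspan B"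
    by (rule complex_vector.basis_exists[of W])
  have "finite B"
    using complex_vector.independent_span_bound[OF F(1) B(2)] B(1) by (auto simp: W_def)
  have "\<forall>b\<in>B. \<exists>y. y \<in> ?N \<and> y - b \<in> R"
    using B(1) by (auto simp: W_def)
  from bchoice[OF this] obtain Y where Y: "\<forall>b\<in>B. Y b \<in> ?N \<and> Y b - b \<in> R"
    by (rule exE)
  have lift: "\<exists>y\<in>cspan (Y ` B). y - s \<in> R" if "s \<in> cspan B" for s
    using that
  proof (induction rule: complex_vector.span_induct)
    show "csubspace {s. \<exists>y\<in>cspan (Y ` B). y - s \<in> R}"
    proof (rule complex_vector.subspaceI)
      show "0 \<in> {s. \<exists>y\<in>cspan (Y ` B). y - s \<in> R}"
        using complex_vector.span_zero complex_vector.subspace_0[OF R] by auto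
    next
      fix s t
      assume "s \<in> {s. \<exists>y\<in>cspan (Y ` B). y - s \<in> R}" "t \<in> {s. \<exists>y\<in>cspan (Y ` B). y - s \<in> R}"
      then obtain y y' where "y \<in> cspan (Y ` B)" "y - s \<in> R" "y' \<in> cspan (Y ` B)" "y' - t \<in> R"
        by blast
      then have "y + y' \<in> cspan (Y ` B)" "(y + y') - (s + t) \<in> R"
        using complex_vector.subspace_add[OF R, of "y - s" "y' - t"]
        by (simp_all add: complex_vector.span_add add_diff_add)
      then show "s + t \<in> {s. \<exists>y\<in>cspan (Y ` B). y - s \<in> R}"
        by blast
    next
      fix c s
      assume "s \<in> {s. \<exists>y\<in>cspan (Y ` B). y - s \<in> R}"
      then obtain y where "y \<in> cspan (Y ` B)" "y - s \<in> R"
        by blast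
      then have "c *\<^sub>C y \<in> cspan (Y ` B)" "c *\<^sub>C y - c *\<^sub>C s \<in> R"
        using complex_vector.subspace_scale[OF R, of "y - s" c]
        by (simp_all add: complex_vector.span_scale complex_vector.scale_right_diff_distrib)
      then show "c *\<^sub>C s \<in> {s. \<exists>y\<in>cspan (Y ` B). y - s \<in> R}"
        by blast
    qed
  next
    fix b assume "b \<in> B"
    then show "\<exists>y\<in>cspan (Y ` B). y - b \<in> R"
      using Y by (intro bexI[of _ "Y b"] complex_vector.span_base) auto
  qed
  have "?N \<subseteq> cspan (Y ` B)"
  proof
    fix y assume y: "y \<in> ?N"
    obtain z where z: "z \<in> R" "y - z \<in> cspan F"
      using F(2) by blast
    then have "y - z \<in> W"
      using y by (simp only: W_def mem_Collect_eq) (intro conjI bexI[of _ y]; simp)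
    then obtain y' where y': "y' \<in> cspan (Y ` B)" "y' - (y - z) \<in> R"
      using lift B(3) by blast
    have "(y' - (y - z)) - z \<in> R"
      using y'(2) z(1) by (rule complex_vector.subspace_diff[OF R])
    then have "y' - y \<in> R"
      by simp
    moreover have "cspan (Y ` B) \<subseteq> ?N"
      using Y by (intro complex_vector.span_minimal N) blast
    then have "y' - y \<in> ?N"
      using y y'(1) by (intro complex_vector.subspace_diff[OF N]) (rule subsetD)
    ultimately have "cinner (y' - y) (y' - y) = 0"
      by blast
    then show "y \<in> cspan (Y ` B)"
      using y'(1) by (simp add: cinner_self)
  qed
  then show ?thesis
    unfolding cfinite_dim_def using \<open>finite B\<close> by blast
qed

section \<open>Fredholm Fourier multipliers\<close>

context
  fixes \<sigma> :: "int^'n::finite \<Rightarrow> ('h::{complex_hilbert, second_countable_topology} \<rightharpoonup> 'h)"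
  assumes \<sigma>: "\<And>\<eta>. closed_densely_defined (\<sigma> \<eta>)"
begin

text \<open>Bessel's inequality provides the summability that the domain asks for, and injectivity
  of the Fourier transform identifies the function picked by the definite description.\<close>

lemma multiplier_eqI:
  assumes fg: "\<And>\<xi>. \<sigma> \<xi> (fourier f \<xi>) = Some (fourier g \<xi>)"
  shows "multiplier \<sigma> f = Some g"
proof -
  have "(\<lambda>\<xi>. (norm (fourier g \<xi>))\<^sup>2) summable_on UNIV"
    by (rule nonneg_bdd_above_summable_on)
      (auto intro!: bdd_aboveI2[where M="(norm g)\<^sup>2"] bessel_inequality)
  moreover have "(THE g'. \<forall>\<xi>. fourier g' \<xi> = fourier g \<xi>) = g"
    by (intro the_equality) (auto intro: fourier_inject)
  ultimately show ?thesis
    using fg by (auto simp: multiplier_def)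
qed

lemma multiplier_fourier_mode:
  assumes "\<sigma> \<xi> x = Some y"
  shows "multiplier \<sigma> (fourier_mode \<xi> x) = Some (fourier_mode \<xi> y)"
proof (rule multiplier_eqI)
  show "\<sigma> \<eta> (fourier (fourier_mode \<xi> x) \<eta>) = Some (fourier (fourier_mode \<xi> y) \<eta>)" for \<eta>
    using assms by (cases "\<xi> = \<eta>") (simp_all add: fourier_fourier_mode op_zero[OF \<sigma>])
qed

text \<open>Linearity of the multiplier replaces the Riesz-Fischer theorem here. If there were no
  function with the prescribed coefficients, there would also be none after removal of one Fourier
  mode from \<open>f\<close>; the definite description would yield the same junk value for both, and so the
  multiplier would annihilate every Fourier mode of \<open>f\<close>.\<close>

lemma multiplier_eq_Some_iff:
  assumes A: "closed_densely_defined (multiplier \<sigma>)"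
  shows "multiplier \<sigma> f = Some g \<longleftrightarrow> (\<forall>\<xi>. \<sigma> \<xi> (fourier f \<xi>) = Some (fourier g \<xi>))"
proof
  assume *: "multiplier \<sigma> f = Some g"
  then have dom: "fourier f \<xi> \<in> dom (\<sigma> \<xi>)" for \<xi>
    by (auto simp: multiplier_def split: if_splits)
  then obtain v where v: "\<And>\<xi>. \<sigma> \<xi> (fourier f \<xi>) = Some (v \<xi>)"
  proof -
    have "\<forall>\<xi>. \<exists>v. \<sigma> \<xi> (fourier f \<xi>) = Some v"
      using dom by blast
    from choice[OF this] show ?thesis
      by (elim exE) (rule that, erule spec)
  qed
  have ex: "\<exists>u. \<forall>\<xi>. fourier u \<xi> = v \<xi>"
  proof (rule ccontr)
    assume none: "\<nexists>u. \<forall>\<xi>. fourier u \<xi> = v \<xi>"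
    have "v \<eta> = 0" for \<eta>
    proof -
      let ?f = "f - fourier_mode \<eta> (fourier f \<eta>)"
      let ?w = "\<lambda>\<xi>. v \<xi> - fourier (fourier_mode \<eta> (v \<eta>)) \<xi>"
      have \<sigma>f: "\<sigma> \<xi> (fourier ?f \<xi>) = Some (?w \<xi>)" for \<xi>
        using v[of \<xi>] op_zero[OF \<sigma>] by (auto simp: fourier_diff fourier_fourier_mode)
      have none': "\<nexists>u. \<forall>\<xi>. fourier u \<xi> = ?w \<xi>"
      proof
        assume "\<exists>u. \<forall>\<xi>. fourier u \<xi> = ?w \<xi>"
        then obtain u where "\<forall>\<xi>. fourier u \<xi> = ?w \<xi>" ..
        then have "\<forall>\<xi>. fourier (u + fourier_mode \<eta> (v \<eta>)) \<xi> = v \<xi>"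
          by (simp add: fourier_add)
        with none show False
          by blast
      qed
      have diff: "multiplier \<sigma> ?f = Some (g - fourier_mode \<eta> (v \<eta>))"
        using op_diff[OF A * multiplier_fourier_mode[OF v]] .
      then have "g - fourier_mode \<eta> (v \<eta>) = (THE u. \<forall>\<xi>. fourier u \<xi> = ?w \<xi>)"
        unfolding multiplier_def \<sigma>f by (simp split: if_splits)
      \<comment> \<open>Without solutions both descriptions are \<open>The\<close> applied to the
        predicate that is constantly false.\<close>
      also have "\<dots> = (THE u. \<forall>\<xi>. fourier u \<xi> = v \<xi>)"
        using none none' by (intro arg_cong[where f=The] ext) blast
      also have "\<dots> = g"
        using * unfolding multiplier_def v by (simp split: if_splits)
      finally have "fourier (fourier_mode \<eta> (v \<eta>)) \<eta> = 0"
        by (simp add: fourier_zero)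
      then show "v \<eta> = 0"
        by (simp add: fourier_fourier_mode)
    qed
    \<comment> \<open>Vanishing of all \<open>v \<eta>\<close> is contradictory in turn: the zero
      function then has the prescribed coefficients.\<close>
    then have "\<forall>\<xi>. fourier 0 \<xi> = v \<xi>"
      by (simp add: fourier_zero)
    with none show False
      by blast
  qed
  then obtain u where u: "\<forall>\<xi>. fourier u \<xi> = v \<xi>" ..
  then have "multiplier \<sigma> f = Some u"
    using v by (intro multiplier_eqI) simp
  with * u v show "\<forall>\<xi>. \<sigma> \<xi> (fourier f \<xi>) = Some (fourier g \<xi>)"
    by simp
qed (auto intro: multiplier_eqI)

lemma op_ker_multiplier:
  assumes "closed_densely_defined (multiplier \<sigma>)"
  shows "op_ker (multiplier \<sigma>) = {f. \<forall>\<xi>. fourier f \<xi> \<in> op_ker (\<sigma> \<xi>)}"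
  by (simp add: op_ker_def multiplier_eq_Some_iff[OF assms] fourier_zero)

text \<open>Testing against modes of vectors in \<open>ran (\<sigma> \<xi>)\<close> isolates the
  coefficient of \<open>g\<close> at \<open>\<xi>\<close>. Conversely, every value of the multiplier
  has its coefficients in these ranges, and coefficientwise orthogonality implies
  orthogonality.\<close>

lemma op_ker_adjoint_multiplier:
  assumes A: "closed_densely_defined (multiplier \<sigma>)"
  shows "op_ker (adjoint_op (multiplier \<sigma>)) = {g. \<forall>\<xi>. fourier g \<xi> \<in> op_ker (adjoint_op (\<sigma> \<xi>))}"
proof (intro equalityI subsetI)
  fix g assume g: "g \<in> op_ker (adjoint_op (multiplier \<sigma>))"
  have "cinner y (fourier g \<xi>) = 0" if "y \<in> ran (\<sigma> \<xi>)" for \<xi> y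
  proof -
    have "fourier_mode \<xi> y \<in> ran (multiplier \<sigma>)"
      using that multiplier_fourier_mode by (fastforce simp: ran_def)
    then have "cinner (fourier_mode \<xi> y) g = 0"
      using g unfolding op_ker_adjoint[OF A] by blast
    then show ?thesis
      by (metis cinner_commute cinner_fourier_mode complex_cnj_zero)
  qed
  then show "g \<in> {g. \<forall>\<xi>. fourier g \<xi> \<in> op_ker (adjoint_op (\<sigma> \<xi>))}"
    by (simp add: op_ker_adjoint[OF \<sigma>])
next
  fix g assume "g \<in> {g. \<forall>\<xi>. fourier g \<xi> \<in> op_ker (adjoint_op (\<sigma> \<xi>))}"
  then have g: "cinner y (fourier g \<xi>) = 0" if "y \<in> ran (\<sigma> \<xi>)" for \<xi> y
    using that by (simp add: op_ker_adjoint[OF \<sigma>])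
  have "cinner u g = 0" if u: "u \<in> ran (multiplier \<sigma>)" for u
  proof -
    obtain f where "multiplier \<sigma> f = Some u"
      using u by (auto simp: ran_def)
    then have "fourier u \<xi> \<in> ran (\<sigma> \<xi>)" for \<xi>
      by (auto simp: multiplier_eq_Some_iff[OF A] intro: ranI)
    then show ?thesis
      by (intro cinner_eq_0_if_fourier g)
  qed
  then show "g \<in> op_ker (adjoint_op (multiplier \<sigma>))"
    by (simp add: op_ker_adjoint[OF A])
qed

text \<open>Written as a preimage, the range of a symbol inherits closedness from the range of the
  multiplier, since the mode embedding is continuous.\<close>

lemma ran_symbol_eq:
  assumes A: "closed_densely_defined (multiplier \<sigma>)"
  shows "ran (\<sigma> \<xi>) = fourier_mode \<xi> -` ran (multiplier \<sigma>)"
proof (intro equalityI subsetI)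
  fix y assume "y \<in> ran (\<sigma> \<xi>)"
  then show "y \<in> fourier_mode \<xi> -` ran (multiplier \<sigma>)"
    using multiplier_fourier_mode by (fastforce simp: ran_def)
next
  fix y assume "y \<in> fourier_mode \<xi> -` ran (multiplier \<sigma>)"
  then obtain f where "multiplier \<sigma> f = Some (fourier_mode \<xi> y)"
    by (auto simp: ran_def)
  then have "\<sigma> \<xi> (fourier f \<xi>) = Some y"
    by (auto simp: multiplier_eq_Some_iff[OF A] fourier_fourier_mode dest: spec[of _ \<xi>])
  then show "y \<in> ran (\<sigma> \<xi>)"
    by (rule ranI)
qed

context
  assumes fredholm: "fredholm (multiplier \<sigma>)"
begin

text \<open>Vectors go up through \<open>fourier_mode \<eta>\<close> to a space where finitely many
  functions \<open>F\<close> suffice, and come back through the coefficient at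
  \<open>\<eta>\<close>. The coefficients of \<open>F\<close> at \<open>\<eta>\<close> therefore
  suffice for \<open>\<sigma> \<eta>\<close>, both for the kernel and for the cokernel.\<close>

lemma fredholm_symbol: "fredholm (\<sigma> \<eta>)"
  unfolding fredholm_def
proof (intro conjI)
  have A: "closed_densely_defined (multiplier \<sigma>)" and ker: "cfinite_dim (op_ker (multiplier \<sigma>))"
    and ran: "closed (ran (multiplier \<sigma>))"
    and coker: "\<exists>F. finite F \<and> (\<forall>y. \<exists>z\<in>ran (multiplier \<sigma>). y - z \<in> cspan F)"
    using fredholm unfolding fredholm_def by blast+
  show "closed_densely_defined (\<sigma> \<eta>)"
    by (rule \<sigma>)
  show "closed (ran (\<sigma> \<eta>))"
    unfolding ran_symbol_eq[OF A]
    using ran linear_continuous_on[OF bounded_linear_fourier_mode]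
    by (rule closed_vimage)
  obtain F where F: "finite F" "op_ker (multiplier \<sigma>) \<subseteq> cspan F"
    using ker unfolding cfinite_dim_def by blast
  have "op_ker (\<sigma> \<eta>) \<subseteq> cspan ((\<lambda>f. fourier f \<eta>) ` F)"
  proof
    fix x assume "x \<in> op_ker (\<sigma> \<eta>)"
    then have "fourier_mode \<eta> x \<in> cspan F"
      using F(2) multiplier_fourier_mode[of \<eta> x 0] by (auto simp: op_ker_def fourier_mode_zero)
    from fourier_span[OF this, of \<eta>] show "x \<in> cspan ((\<lambda>f. fourier f \<eta>) ` F)"
      by (simp add: fourier_fourier_mode)
  qed
  then show "cfinite_dim (op_ker (\<sigma> \<eta>))"
    unfolding cfinite_dim_def using F(1) by blast
  obtain F where F: "finite F" "\<And>y. \<exists>z\<in>ran (multiplier \<sigma>). y - z \<in> cspan F"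
    using coker by blast
  have "\<exists>z\<in>ran (\<sigma> \<eta>). y - z \<in> cspan ((\<lambda>f. fourier f \<eta>) ` F)" for y
  proof -
    obtain z f where z: "multiplier \<sigma> f = Some z" "fourier_mode \<eta> y - z \<in> cspan F"
      using F(2)[of "fourier_mode \<eta> y"] by (auto simp: ran_def)
    have "y - fourier z \<eta> \<in> cspan ((\<lambda>f. fourier f \<eta>) ` F)"
      using fourier_span[OF z(2), of \<eta>] by (simp add: fourier_diff fourier_fourier_mode)
    moreover have "fourier z \<eta> \<in> ran (\<sigma> \<eta>)"
      using z(1) by (auto simp: multiplier_eq_Some_iff[OF A] intro: ranI)
    ultimately show ?thesis
      by blast
  qed
  then show "\<exists>F. finite F \<and> (\<forall>y. \<exists>z\<in>ran (\<sigma> \<eta>). y - z \<in> cspan F)"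
    using F(1) by blast
qed

lemma Ind_multiplier: "((\<lambda>\<eta>. Ind (\<sigma> \<eta>)) has_sum Ind (multiplier \<sigma>)) UNIV"
proof -
  have A: "closed_densely_defined (multiplier \<sigma>)"
    using fredholm by (simp add: fredholm_def)
  have ker: "cfinite_dim {f. \<forall>\<xi>. fourier f \<xi> \<in> op_ker (\<sigma> \<xi>)}"
    using fredholm by (simp add: fredholm_def op_ker_multiplier[OF A, symmetric])
  obtain S where S: "finite S" "\<And>\<xi>. \<xi> \<notin> S \<Longrightarrow> cdim (op_ker (\<sigma> \<xi>)) = 0"
    "cdim (op_ker (multiplier \<sigma>)) = (\<Sum>\<xi>\<in>S. cdim (op_ker (\<sigma> \<xi>)))"
    unfolding op_ker_multiplier[OF A]
    by (fact cdim_fourier_subspace[OF csubspace_op_ker[OF \<sigma>] ker])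
  obtain F where "finite F" "\<forall>y. \<exists>z\<in>ran (multiplier \<sigma>). y - z \<in> cspan F"
    using fredholm unfolding fredholm_def by blast
  then have "cfinite_dim (op_ker (adjoint_op (multiplier \<sigma>)))"
    unfolding op_ker_adjoint[OF A] by (intro cfinite_dim_orthogonal[OF csubspace_ran[OF A]]) auto
  then have adj: "cfinite_dim {f. \<forall>\<xi>. fourier f \<xi> \<in> op_ker (adjoint_op (\<sigma> \<xi>))}"
    unfolding op_ker_adjoint_multiplier[OF A] .
  obtain T where T: "finite T" "\<And>\<xi>. \<xi> \<notin> T \<Longrightarrow> cdim (op_ker (adjoint_op (\<sigma> \<xi>))) = 0"
    "cdim (op_ker (adjoint_op (multiplier \<sigma>))) = (\<Sum>\<xi>\<in>T. cdim (op_ker (adjoint_op (\<sigma> \<xi>))))"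
    unfolding op_ker_adjoint_multiplier[OF A]
    by (fact cdim_fourier_subspace[OF csubspace_op_ker_adjoint[OF \<sigma>] adj])
  \<comment> \<open>Both sums are extended by zeros to \<open>S \<union> T\<close>, where the
    differences can be formed term by term; outside this set every index is 0.\<close>
  have "(\<Sum>\<xi>\<in>S. cdim (op_ker (\<sigma> \<xi>))) = (\<Sum>\<xi>\<in>S \<union> T. cdim (op_ker (\<sigma> \<xi>)))"
    "(\<Sum>\<xi>\<in>T. cdim (op_ker (adjoint_op (\<sigma> \<xi>)))) = (\<Sum>\<xi>\<in>S \<union> T. cdim (op_ker (adjoint_op (\<sigma> \<xi>))))"
    using S T by (auto intro!: sum.mono_neutral_left)
  then have "Ind (multiplier \<sigma>) = (\<Sum>\<eta>\<in>S \<union> T. Ind (\<sigma> \<eta>))"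
    by (simp add: Ind_def S(3) T(3) sum_subtractf)
  then show ?thesis
    using S(1,2) T(1,2) by (intro has_sum_finite_neutralI[of "S \<union> T"]) (auto simp: Ind_def)
qed

end

end

text \<open>The Fredholm property of the symbols, stated alongside the formula, ensures that every
  summand is a difference of genuine finite dimensions and not of default values of
  \<open>cdim\<close>.\<close>

theorem theorem4p6:
  fixes e :: "int^'k::finite \<Rightarrow> 'h::{complex_hilbert, second_countable_topology}"
    and \<sigma> :: "int^'n::finite \<Rightarrow> ('h \<rightharpoonup> 'h)"
    and m :: real
  assumes "\<not> cfinite_dim (UNIV :: 'h set)"
    and "orthonormal_basis e"
    and "m > 0"
    and "\<And>\<eta>. closed_densely_defined (\<sigma> \<eta>)"
    and "\<And>\<eta>. range e \<subseteq> dom (\<sigma> \<eta>)"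
    and "fredholm (multiplier \<sigma>)"
    and "elliptic m e \<sigma>"
  shows "(\<forall>\<eta>. fredholm (\<sigma> \<eta>)) \<and>
         ((\<lambda>\<eta>. Ind (\<sigma> \<eta>)) has_sum Ind (multiplier \<sigma>)) UNIV"
  using fredholm_symbol[OF assms(4,6)] Ind_multiplier[OF assms(4,6)] by blast

end
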